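(* If $x\in\mathbb{R}$ is Schnorr random and $f$ is an $L^1(\mathbb{R})$-computable function, then $\lim_{y\to 0^+}P[f](x,y)=f(x)$.
   Context: Randomness on $\mathbb{R}$ is with respect to Lebesgue measure $\lambda$. A Schnorr test is a sequence $\{V_k\}_k$ of uniformly effectively open ($\Sigma^0_1$) subsets of $\mathbb{R}$ (uniformly computably enumerable unions of rational open intervals) with $\lambda(V_k)\le 2^{-k}$ and $\lambda(V_k)$ computable uniformly in $k$; $x$ is Schnorr random if $x\notin\bigcap_k V_k$ for every Schnorr test. A function $f\in L^1(\mathbb{R})$ is $L^1(\mathbb{R})$-computable if there is a computable sequence $\{f_n\}_n$ of compactly supported continuous piecewise linear functions with rational vertices converging to $f$ in $L^1$ with a computable modulus of convergence; the value $f(x)$ is understood as $\lim_n f_n(x)$ for such an approximating sequence. The Poisson kernel is $P_y(s)=\frac{1}{\pi}\frac{y}{s^2+y^2}$ for $y>0$, and the Poisson integral is $P[f](x,y)=\int_{\mathbb{R}}P_y(x-t)f(t)\,dt$ for $x\in\mathbb{R}$, $y>0$. *)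

theory Defs
  imports "HOL-Analysis.Analysis" "HOL-Library.Nat_Bijection" "HOL-Library.Countable"
begin

text \<open>
  The total recursive functions, as the least class closed under primitive recursion and
  minimization of regular functions. Functions of several arguments are treated as unary ones
  through the pairing function \<^const>\<open>prod_encode\<close>. Restricting minimization to regular
  functions loses no total function, by the Kleene normal form theorem.
\<close>

inductive computable :: "(nat \<Rightarrow> nat) \<Rightarrow> bool" where
  zero: "computable (\<lambda>_. 0)"
| succ: "computable Suc"
| left: "computable (\<lambda>n. fst (prod_decode n))"
| right: "computable (\<lambda>n. snd (prod_decode n))"
| pair: "computable f \<Longrightarrow> computable g \<Longrightarrow> computable (\<lambda>n. prod_encode (f n, g n))"
| comp: "computable f \<Longrightarrow> computable g \<Longrightarrow> computable (\<lambda>n. f (g n))"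
| prim_rec: "computable f \<Longrightarrow> computable g \<Longrightarrow>
    computable (\<lambda>n. case prod_decode n of (a, k) \<Rightarrow>
      rec_nat (f a) (\<lambda>i r. g (prod_encode (a, prod_encode (i, r)))) k)"
| minimization: "computable f \<Longrightarrow> \<forall>a. \<exists>k. f (prod_encode (a, k)) = 0 \<Longrightarrow>
    computable (\<lambda>a. LEAST k. f (prod_encode (a, k)) = 0)"

definition rational_of_code :: "nat \<Rightarrow> real" where
  "rational_of_code n = of_rat (nat_to_rat_surj n)"

text \<open>Codes of intervals with reversed endpoints denote the empty set, so that a total function
  can also enumerate a finite or empty family of intervals.\<close>

definition interval_of_code :: "nat \<Rightarrow> real set" where
  "interval_of_code n = (case prod_decode n of (a, b) \<Rightarrow>
     {rational_of_code a <..< rational_of_code b})"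

definition uniformly_effectively_open :: "(nat \<Rightarrow> real set) \<Rightarrow> bool" where
  "uniformly_effectively_open V \<longleftrightarrow>
     (\<exists>h. computable h \<and> (\<forall>k. V k = (\<Union>i. interval_of_code (h (prod_encode (k, i))))))"

definition uniformly_computable_reals :: "(nat \<Rightarrow> real) \<Rightarrow> bool" where
  "uniformly_computable_reals r \<longleftrightarrow>
     (\<exists>q. computable q \<and>
        (\<forall>k n. \<bar>rational_of_code (q (prod_encode (k, n))) - r k\<bar> \<le> 1 / 2 ^ n))"

definition schnorr_test :: "(nat \<Rightarrow> real set) \<Rightarrow> bool" where
  "schnorr_test V \<longleftrightarrow>
     uniformly_effectively_open V \<and>
     (\<forall>k. emeasure lborel (V k) \<le> ennreal (1 / 2 ^ k)) \<and>
     uniformly_computable_reals (\<lambda>k. measure lborel (V k))"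

definition schnorr_random :: "real \<Rightarrow> bool" where
  "schnorr_random x \<longleftrightarrow> (\<forall>V. schnorr_test V \<longrightarrow> x \<notin> (\<Inter>k. V k))"

text \<open>Linear interpolation of a list of vertices, extended by zero.\<close>

fun piecewise_linear :: "(real \<times> real) list \<Rightarrow> real \<Rightarrow> real" where
  "piecewise_linear ((a, u) # (b, v) # ps) x =
     (if x < a then 0
      else if x \<le> b then u + (v - u) * (x - a) / (b - a)
      else piecewise_linear ((b, v) # ps) x)"
| "piecewise_linear _ x = 0"

text \<open>The vertex lists whose interpolation is continuous: strictly increasing abscissae, and value
  zero at the first and the last vertex.\<close>

definition vertex_list :: "(real \<times> real) list \<Rightarrow> bool" where
  "vertex_list ps \<longleftrightarrow> sorted_wrt (<) (map fst ps) \<and>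
     (ps \<noteq> [] \<longrightarrow> snd (hd ps) = 0 \<and> snd (last ps) = 0)"

definition vertices_of_code :: "nat \<Rightarrow> (real \<times> real) list" where
  "vertices_of_code n =
     map (\<lambda>j. case prod_decode j of (a, b) \<Rightarrow> (rational_of_code a, rational_of_code b))
       (list_decode n)"

definition computable_pl_sequence :: "(nat \<Rightarrow> real \<Rightarrow> real) \<Rightarrow> bool" where
  "computable_pl_sequence F \<longleftrightarrow>
     (\<exists>c. computable c \<and>
        (\<forall>n. vertex_list (vertices_of_code (c n)) \<and>
             F n = piecewise_linear (vertices_of_code (c n))))"

definition L1_approximation ::
    "(nat \<Rightarrow> real \<Rightarrow> real) \<Rightarrow> (nat \<Rightarrow> nat) \<Rightarrow> (real \<Rightarrow> real) \<Rightarrow> bool" where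
  "L1_approximation F m f \<longleftrightarrow>
     computable_pl_sequence F \<and> computable m \<and>
     (\<forall>n. \<forall>k\<ge>m n. (LINT t|lebesgue. \<bar>F k t - f t\<bar>) \<le> 1 / 2 ^ n)"

definition L1_computable :: "(real \<Rightarrow> real) \<Rightarrow> bool" where
  "L1_computable f \<longleftrightarrow> integrable lebesgue f \<and> (\<exists>F m. L1_approximation F m f)"

text \<open>
  The value of an \<open>L\<^sup>1\<close>-computable function at a point, independent of the representative \<open>f\<close> and
  of the choice of the approximating sequence. The limit is taken along the modulus, i.e. for the
  sequence \<open>f\<^sub>n = F (m n)\<close>, which satisfies \<open>\<parallel>f\<^sub>n - f\<parallel> \<le> 2\<^sup>-\<^sup>n\<close>: slow convergence in
  \<open>L\<^sup>1\<close>, even with a computable modulus, does not give pointwise convergence (moving bumps).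
\<close>

definition L1_value :: "(real \<Rightarrow> real) \<Rightarrow> real \<Rightarrow> real \<Rightarrow> bool" where
  "L1_value f x v \<longleftrightarrow> L1_computable f \<and>
     (\<forall>F m. L1_approximation F m f \<longrightarrow> (\<lambda>n. F (m n) x) \<longlonglongrightarrow> v)"

lemma L1_value_unique: "L1_value f x v \<Longrightarrow> L1_value f x w \<Longrightarrow> v = w"
  unfolding L1_value_def L1_computable_def by (blast intro: LIMSEQ_unique)

definition poisson_kernel :: "real \<Rightarrow> real \<Rightarrow> real" where
  "poisson_kernel y s = 1 / pi * (y / (s\<^sup>2 + y\<^sup>2))"

definition poisson_integral :: "(real \<Rightarrow> real) \<Rightarrow> real \<Rightarrow> real \<Rightarrow> real" where
  "poisson_integral f x y = (LINT t|lebesgue. poisson_kernel y (x - t) * f t)"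

end

theory Submission
  imports Defs "HOL-Probability.Sinc_Integral" "HOL-Probability.Characteristic_Functions"
begin

text \<open>
  Let \<open>G\<^sub>n\<close> be piecewise linear with \<open>\<parallel>G\<^sub>n - f\<parallel> \<le> 4\<^sup>-\<^sup>n\<close> and put \<open>H\<^sub>n = \<bar>G\<^sub>n\<^sub>+\<^sub>1 - G\<^sub>n\<bar>\<close>. The code of
  \<open>G\<^sub>n\<close> bounds its support and its Lipschitz constant, hence \<open>H\<^sub>n\<close> can be sampled on a computable
  dyadic grid with negligible error. The grid cells to the left or right of which the samples
  have some average above \<open>2\<^sup>-\<^sup>n\<close> form a decidable finite set, of measure \<open>O(2\<^sup>-\<^sup>n)\<close> by a
  discrete rising sun lemma. Since these are finite unions of dyadic intervals, the measures of
  the tail unions are computable, so that a Schnorr random \<open>x\<close> is in only finitely many of them.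
  For all other \<open>n\<close> both \<open>H\<^sub>n x\<close> and the averages of \<open>H\<^sub>n\<close> around \<open>x\<close> are \<open>O(2\<^sup>-\<^sup>n)\<close>, and
  the latter control \<open>P[H\<^sub>n](x, y)\<close> uniformly in \<open>y\<close>. Thus \<open>G\<^sub>n x\<close> converges, and
  \<open>P[G\<^sub>n](x, y)\<close> tends to \<open>P[f](x, y)\<close> uniformly in \<open>y\<close>, which gives the limit because each
  \<open>G\<^sub>n\<close> is continuous.
\<close>

subsection \<open>Closure properties of the computable functions\<close>

text \<open>A Schnorr test must have computable measures, and superlevel sets of a maximal function
  offer no evident way to compute theirs. This is the reason for sampling: on a grid every average
  is an exact rational, so comparing it with the threshold is decidable, and the exceptional set is
  a finite union of grid intervals whose measure is a count of cells. The computability part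
  therefore works with exact rationals and not with computable reals, whose order is not decidable.
  The rate \<open>4^-n\<close> against the threshold \<open>2^-n\<close> leaves a measure of order
  \<open>2^-n\<close> in the weak type inequality, and this decay makes the tail unions computable
  in measure. A general approximation only has the rate \<open>2^-n\<close> along its modulus; its
  even and odd subsequences have the rate \<open>4^-n\<close>, and both of their limits are
  identified with the Poisson limit, which does not involve the approximation. Hence the value at
  \<open>x\<close> and the Poisson limit are obtained together. Uniformity in \<open>y\<close>
  cannot come from \<open>L^1\<close> convergence, as the kernel bound \<open>1 / (pi * y)\<close>
  blows up; it comes from the maximal bounds on the increments.\<close>

lemma computable_ident: "computable (\<lambda>n. n)"
  using computable.pair[OF computable.left computable.right] by simp

lemma computable_const: "computable (\<lambda>_. c)"
  by (induction c) (auto intro: computable.zero computable.comp[OF computable.succ])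

lemma computable_Suc: "computable f \<Longrightarrow> computable (\<lambda>n. Suc (f n))"
  by (rule computable.comp[OF computable.succ])

lemma computable_fst: "computable f \<Longrightarrow> computable (\<lambda>n. fst (prod_decode (f n)))"
  by (rule computable.comp[OF computable.left])

lemma computable_snd: "computable f \<Longrightarrow> computable (\<lambda>n. snd (prod_decode (f n)))"
  by (rule computable.comp[OF computable.right])

lemmas computable_basic =
  computable_ident computable_const computable_Suc computable_fst computable_snd computable.pair

text \<open>The entire input \<open>n\<close> serves as the parameter of the recursion, so that both
  the start and the step may depend on it. The second premise unpacks the triple of parameter,
  counter and previous value as coded in the primitive recursion scheme.\<close>

lemma computable_rec_nat:
  assumes "computable f"
    and "computable (\<lambda>m. g (fst (prod_decode m)) (fst (prod_decode (snd (prod_decode m))))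
           (snd (prod_decode (snd (prod_decode m)))))"
    and "computable k"
  shows "computable (\<lambda>n. rec_nat (f n) (g n) (k n))"
  using computable.comp[OF computable.prim_rec[OF assms(1,2)]
      computable.pair[OF computable_ident assms(3)]]
  by simp

lemma computable_add:
  assumes "computable f" "computable g"
  shows "computable (\<lambda>n. f n + g n)"
proof -
  have "rec_nat a (\<lambda>_. Suc) b = a + b" for a b
    by (induction b) auto
  moreover have "computable (\<lambda>n. rec_nat (f n) (\<lambda>_. Suc) (g n))"
    by (intro computable_rec_nat computable_basic assms)
  ultimately show ?thesis by simp
qed

lemma computable_mult:
  assumes "computable f" "computable g"
  shows "computable (\<lambda>n. f n * g n)"
proof -
  have "rec_nat 0 (\<lambda>_ r. r + a) b = a * b" for a b :: nat
    by (induction b) auto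
  moreover have "computable (\<lambda>n. rec_nat 0 (\<lambda>_ r. r + f n) (g n))"
    by (intro computable_rec_nat computable_add computable_basic assms computable.comp[OF assms(1)])
  ultimately show ?thesis by simp
qed

lemma computable_diff:
  assumes "computable f" "computable g"
  shows "computable (\<lambda>n. f n - g n)"
proof -
  \<comment> \<open>The step returns its counter and discards the previous value, which yields the
    predecessor.\<close>
  have pred_eq: "a - 1 = rec_nat 0 (\<lambda>i _. i) a" for a
    by (cases a) auto
  have pred: "computable (\<lambda>n. h n - 1)" if "computable h" for h
    unfolding pred_eq by (intro computable_rec_nat computable_basic that)
  have "rec_nat a (\<lambda>_ r. r - 1) b = a - b" for a b :: nat
    by (induction b) auto
  moreover have "computable (\<lambda>n. rec_nat (f n) (\<lambda>_ r. r - 1) (g n))"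
    by (intro computable_rec_nat pred computable_basic assms)
  ultimately show ?thesis by simp
qed

lemma computable_power:
  assumes "computable f" "computable g"
  shows "computable (\<lambda>n. f n ^ g n)"
proof -
  have "rec_nat 1 (\<lambda>_ r. r * a) b = a ^ b" for a b :: nat
    by (induction b) auto
  moreover have "computable (\<lambda>n. rec_nat 1 (\<lambda>_ r. r * f n) (g n))"
    by (intro computable_rec_nat computable_mult computable_basic assms computable.comp[OF assms(1)])
  ultimately show ?thesis by simp
qed

lemma computable_sum:
  assumes "computable (\<lambda>m. g (fst (prod_decode m)) (snd (prod_decode m)))" "computable k"
  shows "computable (\<lambda>n. \<Sum>i<k n. g n i)"
proof -
  have "rec_nat 0 (\<lambda>i r. r + g n i) b = (\<Sum>i<b. g n i)" for n b
    by (induction b) auto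
  moreover have "computable (\<lambda>n. rec_nat 0 (\<lambda>i r. r + g n i) (k n))"
  proof (intro computable_rec_nat computable_add computable_basic assms(2))
    show "computable (\<lambda>m. g (fst (prod_decode m)) (fst (prod_decode (snd (prod_decode m)))))"
      using computable.comp[OF assms(1), of "\<lambda>m. prod_encode (fst (prod_decode m), fst (prod_decode (snd (prod_decode m))))"]
      by (simp add: computable_basic)
  qed
  ultimately show ?thesis by simp
qed

lemma computable_funpow:
  assumes "computable t" "computable c" "computable k"
  shows "computable (\<lambda>n. (t ^^ k n) (c n))"
proof -
  have "rec_nat a (\<lambda>_. t) b = (t ^^ b) a" for a b
    by (induction b) auto
  moreover have "computable (\<lambda>n. rec_nat (c n) (\<lambda>_. t) (k n))"
    by (intro computable_rec_nat computable.comp[OF assms(1)] computable_basic assms)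
  ultimately show ?thesis by simp
qed

section \<open>Decidable predicates\<close>

definition decidable :: "(nat \<Rightarrow> bool) \<Rightarrow> bool" where
  "decidable P \<longleftrightarrow> computable (\<lambda>n. of_bool (P n))"

lemma computable_of_bool: "decidable P \<Longrightarrow> computable (\<lambda>n. of_bool (P n))"
  by (simp add: decidable_def)

lemma decidable_le:
  assumes "computable f" "computable g"
  shows "decidable (\<lambda>n. f n \<le> g n)"
proof -
  have "of_bool (f n \<le> g n) = 1 - (f n - g n)" for n
    by auto
  then show ?thesis
    by (simp add: decidable_def computable_diff computable_const assms)
qed

lemma decidable_not:
  assumes "decidable P"
  shows "decidable (\<lambda>n. \<not> P n)"
proof -
  have "of_bool (\<not> P n) = 1 - (of_bool (P n) :: nat)" for n
    by auto
  then show ?thesis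
    using assms unfolding decidable_def by (simp only: computable_diff computable_const)
qed

lemma decidable_conj:
  assumes "decidable P" "decidable Q"
  shows "decidable (\<lambda>n. P n \<and> Q n)"
  using assms unfolding decidable_def of_bool_conj by (rule computable_mult)

lemma decidable_disj:
  assumes "decidable P" "decidable Q"
  shows "decidable (\<lambda>n. P n \<or> Q n)"
  using decidable_not[OF decidable_conj[OF decidable_not[OF assms(1)] decidable_not[OF assms(2)]]]
  by simp

lemma decidable_less:
  assumes "computable f" "computable g"
  shows "decidable (\<lambda>n. f n < g n)"
  using decidable_not[OF decidable_le[OF assms(2,1)]] by (simp add: not_le)

lemma decidable_bex:
  assumes "decidable (\<lambda>m. P (fst (prod_decode m)) (snd (prod_decode m)))" "computable k"
  shows "decidable (\<lambda>n. \<exists>i<k n. P n i)"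
proof -
  have "(\<exists>i<k n. P n i) \<longleftrightarrow> 0 < (\<Sum>i<k n. of_bool (P n i) :: nat)" for n
    by (auto simp: sum_pos2 simp flip: neq0_conv)
  moreover have "decidable (\<lambda>n. 0 < (\<Sum>i<k n. of_bool (P n i) :: nat))"
    using assms by (intro decidable_less computable_sum computable_const) (simp_all add: decidable_def)
  ultimately show ?thesis by simp
qed

lemma computable_if:
  assumes "decidable P" "computable f" "computable g"
  shows "computable (\<lambda>n. if P n then f n else g n)"
proof -
  have "(if P n then f n else g n) = of_bool (P n) * f n + of_bool (\<not> P n) * g n" for n
    by auto
  then show ?thesis
    using decidable_not[OF assms(1)] assms
    by (simp only: decidable_def computable_add computable_mult)
qed

lemma decidable_even:
  assumes "computable f"
  shows "decidable (\<lambda>n. even (f n))"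
proof -
  have "rec_nat (1::nat) (\<lambda>_ r. 1 - r) b = of_bool (even b)" for b :: nat
    by (induction b) auto
  moreover have "computable (\<lambda>n. rec_nat 1 (\<lambda>_ r. 1 - r) (f n))"
    by (intro computable_rec_nat computable_diff computable_basic assms)
  ultimately show ?thesis by (simp add: decidable_def)
qed

text \<open>Obtained by counting odd numbers. Halving is needed to evaluate
  \<open>int_decode\<close>, which interleaves the nonnegative and the negative integers.\<close>

lemma computable_half:
  assumes "computable f"
  shows "computable (\<lambda>n. f n div 2)"
proof -
  have "(\<Sum>i<b. of_bool (odd i)) = b div 2" for b :: nat
    by (induction b) (auto elim!: oddE)
  moreover have "computable (\<lambda>n. \<Sum>i<f n. of_bool (odd i))"
    by (intro computable_sum assms decidable_not[unfolded decidable_def]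
        decidable_even[unfolded decidable_def] computable_basic)
  ultimately show ?thesis by simp
qed

lemmas computable_intros = computable_basic computable_add computable_mult computable_diff
  computable_power computable_half computable_if
  decidable_le decidable_less decidable_not decidable_conj decidable_disj decidable_even


subsection \<open>Computable sequences of rational numbers\<close>

text \<open>Exact rationals without integer codes: the sign is absorbed in a difference of naturals
  and \<open>Suc\<close> keeps the denominator positive, so that a comparison becomes an inequality
  between naturals after cross multiplication.\<close>

definition computable_rat :: "(nat \<Rightarrow> real) \<Rightarrow> bool" where
  "computable_rat f \<longleftrightarrow> (\<exists>p q d. computable p \<and> computable q \<and> computable d \<and>
     (\<forall>n. f n = (real (p n) - real (q n)) / real (Suc (d n))))"

lemma computable_ratI:
  assumes "computable p" "computable q" "computable d"
    and "\<And>n. f n = (real (p n) - real (q n)) / real (Suc (d n))"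
  shows "computable_rat f"
  using assms unfolding computable_rat_def by blast

lemma computable_ratE:
  assumes "computable_rat f"
  obtains p q d where "computable p" "computable q" "computable d"
    "f = (\<lambda>n. (real (p n) - real (q n)) / real (Suc (d n)))"
  using assms unfolding computable_rat_def by blast

lemma computable_rat_of_nat: "computable f \<Longrightarrow> computable_rat (\<lambda>n. real (f n))"
  by (rule computable_ratI[of f "\<lambda>_. 0" "\<lambda>_. 0"]) (auto intro: computable_const)

lemma computable_rat_numeral: "computable_rat (\<lambda>_. numeral k)"
  using computable_rat_of_nat[OF computable_const[of "numeral k"]] by simp

lemma computable_rat_0: "computable_rat (\<lambda>_. 0)"
  using computable_rat_of_nat[OF computable_const[of 0]] by simp

lemma computable_rat_1: "computable_rat (\<lambda>_. 1)"
  using computable_rat_of_nat[OF computable_const[of 1]] by simp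

lemma computable_rat_compose:
  assumes "computable_rat f" "computable g"
  shows "computable_rat (\<lambda>n. f (g n))"
  using assms(1)
proof (rule computable_ratE)
  fix p q d
  assume *: "computable p" "computable q" "computable d"
    "f = (\<lambda>n. (real (p n) - real (q n)) / real (Suc (d n)))"
  show ?thesis
    by (rule computable_ratI[OF *(1-3)[THEN computable.comp[OF _ assms(2)]]]) (simp add: *(4))
qed

lemma computable_rat_add:
  assumes "computable_rat f" "computable_rat g"
  shows "computable_rat (\<lambda>n. f n + g n)"
  using assms(1)
proof (rule computable_ratE)
  fix p q d
  assume 1: "computable p" "computable q" "computable d"
    "f = (\<lambda>n. (real (p n) - real (q n)) / real (Suc (d n)))"
  show ?thesis
    using assms(2)
  proof (rule computable_ratE)
    fix p' q' d'
    assume 2: "computable p'" "computable q'" "computable d'"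
      "g = (\<lambda>n. (real (p' n) - real (q' n)) / real (Suc (d' n)))"
    show ?thesis
    proof (rule computable_ratI)
      show "computable (\<lambda>n. p n * Suc (d' n) + p' n * Suc (d n))"
        "computable (\<lambda>n. q n * Suc (d' n) + q' n * Suc (d n))"
        \<comment> \<open>The denominator is stored as its predecessor; the product is positive, so
          the subtraction does not truncate.\<close>
        "computable (\<lambda>n. Suc (d n) * Suc (d' n) - 1)"
        using 1 2 by (auto intro!: computable_intros simp del: mult_Suc mult_Suc_right)
    qed (simp add: 1 2 field_simps)
  qed
qed

lemma computable_rat_mult:
  assumes "computable_rat f" "computable_rat g"
  shows "computable_rat (\<lambda>n. f n * g n)"
  using assms(1)
proof (rule computable_ratE)
  fix p q d
  assume 1: "computable p" "computable q" "computable d"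
    "f = (\<lambda>n. (real (p n) - real (q n)) / real (Suc (d n)))"
  show ?thesis
    using assms(2)
  proof (rule computable_ratE)
    fix p' q' d'
    assume 2: "computable p'" "computable q'" "computable d'"
      "g = (\<lambda>n. (real (p' n) - real (q' n)) / real (Suc (d' n)))"
    show ?thesis
    proof (rule computable_ratI)
      show "computable (\<lambda>n. p n * p' n + q n * q' n)"
        "computable (\<lambda>n. p n * q' n + q n * p' n)"
        "computable (\<lambda>n. Suc (d n) * Suc (d' n) - 1)"
        using 1 2 by (auto intro!: computable_intros simp del: mult_Suc mult_Suc_right)
    qed (simp add: 1 2 field_simps)
  qed
qed

lemma computable_rat_uminus:
  assumes "computable_rat f"
  shows "computable_rat (\<lambda>n. - f n)"
  using assms
proof (rule computable_ratE)
  fix p q d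
  assume *: "computable p" "computable q" "computable d"
    "f = (\<lambda>n. (real (p n) - real (q n)) / real (Suc (d n)))"
  show ?thesis
    by (rule computable_ratI[OF *(2,1,3)]) (simp add: *(4) field_simps)
qed

lemma computable_rat_diff:
  assumes "computable_rat f" "computable_rat g"
  shows "computable_rat (\<lambda>n. f n - g n)"
  using computable_rat_add[OF assms(1) computable_rat_uminus[OF assms(2)]] by simp

lemma computable_rat_inverse:
  assumes "computable_rat f"
  shows "computable_rat (\<lambda>n. inverse (f n))"
  using assms
proof (rule computable_ratE)
  fix p q d
  assume *: "computable p" "computable q" "computable d"
    "f = (\<lambda>n. (real (p n) - real (q n)) / real (Suc (d n)))"
  show ?thesis
  proof (rule computable_ratI)
    show "computable (\<lambda>n. if q n < p n then Suc (d n) else 0)"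
      "computable (\<lambda>n. if p n < q n then Suc (d n) else 0)"
      \<comment> \<open>The sum of the two truncated differences is the distance of
        \<open>p n\<close> and \<open>q n\<close>. If it vanishes, both numerators are 0 and the
        denominator is 1, in accordance with \<open>inverse 0 = 0\<close>.\<close>
      "computable (\<lambda>n. (p n - q n) + (q n - p n) - 1)"
      using * by (intro computable_intros; simp)+
    show "inverse (f n) = (real (if q n < p n then Suc (d n) else 0) -
        real (if p n < q n then Suc (d n) else 0)) / real (Suc ((p n - q n) + (q n - p n) - 1))" for n
      by (cases "p n" "q n" rule: linorder_cases) (auto simp: *(4) of_nat_diff field_simps)
  qed
qed

lemma computable_rat_divide:
  assumes "computable_rat f" "computable_rat g"
  shows "computable_rat (\<lambda>n. f n / g n)"
  using computable_rat_mult[OF assms(1) computable_rat_inverse[OF assms(2)]]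
  by (simp add: divide_inverse)

lemma computable_rat_two_power: "computable k \<Longrightarrow> computable_rat (\<lambda>n. 2 ^ k n)"
  using computable_rat_of_nat[of "\<lambda>n. 2 ^ k n"] by (simp add: computable_intros)

lemma computable_rat_if:
  assumes "decidable P" "computable_rat f" "computable_rat g"
  shows "computable_rat (\<lambda>n. if P n then f n else g n)"
proof -
  have *: "computable_rat (\<lambda>n. real (if P n then 1 else 0))"
    by (intro computable_rat_of_nat computable_if assms computable_const)
  have "(if P n then f n else g n) = real (if P n then 1 else 0) * f n +
      (1 - real (if P n then 1 else 0)) * g n" for n
    by auto
  then show ?thesis
    using * assms(2,3)
    by (simp only: computable_rat_add computable_rat_mult computable_rat_diff computable_rat_1)
qed

lemma decidable_rat_less:
  assumes "computable_rat f" "computable_rat g"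
  shows "decidable (\<lambda>n. f n < g n)"
  using assms(1)
proof (rule computable_ratE)
  fix p q d
  assume 1: "computable p" "computable q" "computable d"
    "f = (\<lambda>n. (real (p n) - real (q n)) / real (Suc (d n)))"
  show ?thesis
    using assms(2)
  proof (rule computable_ratE)
    fix p' q' d'
    assume 2: "computable p'" "computable q'" "computable d'"
      "g = (\<lambda>n. (real (p' n) - real (q' n)) / real (Suc (d' n)))"
    have "f n < g n \<longleftrightarrow>
        real (p n * Suc (d' n) + q' n * Suc (d n)) < real (p' n * Suc (d n) + q n * Suc (d' n))" for n
      by (simp add: 1 2 field_simps)
    then have "f n < g n \<longleftrightarrow> p n * Suc (d' n) + q' n * Suc (d n) < p' n * Suc (d n) + q n * Suc (d' n)" for n
      unfolding of_nat_less_iff .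
    then show ?thesis
      using 1 2 by (auto intro!: computable_intros simp del: mult_Suc mult_Suc_right)
  qed
qed

lemma decidable_rat_le:
  assumes "computable_rat f" "computable_rat g"
  shows "decidable (\<lambda>n. f n \<le> g n)"
  using decidable_not[OF decidable_rat_less[OF assms(2,1)]] by (simp add: not_less)

lemma computable_rat_abs:
  assumes "computable_rat f"
  shows "computable_rat (\<lambda>n. \<bar>f n\<bar>)"
  unfolding abs_if
  by (intro computable_rat_if decidable_rat_less computable_rat_uminus computable_rat_0 assms)

section \<open>Codes of rational numbers\<close>

lemma rational_of_code_eq:
  "rational_of_code n =
     real_of_int (int_decode (fst (prod_decode n))) / real_of_int (int_decode (snd (prod_decode n)))"
proof -
  have "real_of_rat (Fract a b) = real_of_int a / real_of_int b" for a b
    by (simp add: Fract_of_int_quotient of_rat_divide)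
  then show ?thesis
    by (simp add: rational_of_code_def nat_to_rat_surj_def case_prod_beta)
qed

lemma computable_rat_int_decode:
  assumes "computable f"
  shows "computable_rat (\<lambda>n. real_of_int (int_decode (f n)))"
proof (rule computable_ratI)
  show "computable (\<lambda>n. if even (f n) then f n div 2 else 0)"
    "computable (\<lambda>n. if even (f n) then 0 else Suc (f n div 2))"
    by (intro computable_intros assms)+
  show "computable (\<lambda>_. 0)" by (rule computable_const)
qed (auto simp: int_decode_def sum_decode_def)

lemma computable_rat_of_code:
  "computable c \<Longrightarrow> computable_rat (\<lambda>n. rational_of_code (c n))"
  unfolding rational_of_code_eq
  by (intro computable_rat_divide computable_rat_int_decode computable_intros)

lemma computable_rat_obtain_code:
  assumes "computable_rat f"
  obtains c where "computable c" "\<And>n. rational_of_code (c n) = f n"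
  using assms
proof (rule computable_ratE)
  fix p q d
  assume *: "computable p" "computable q" "computable d"
    "f = (\<lambda>n. (real (p n) - real (q n)) / real (Suc (d n)))"
  \<comment> \<open>\<open>int_decode\<close> sends an even code \<open>2 * k\<close> to
    \<open>k\<close> and an odd code \<open>2 * k + 1\<close> to \<open>- k - 1\<close>; hence the
    offset in the negative case.\<close>
  define c where "c n = prod_encode
    (if q n \<le> p n then 2 * (p n - q n) else Suc (2 * (q n - p n - 1)), 2 * Suc (d n))" for n
  have "computable c"
    unfolding c_def by (intro computable_intros *)
  moreover have "rational_of_code (c n) = f n" for n
    by (auto simp: rational_of_code_eq c_def *(4) int_decode_def sum_decode_def of_nat_diff)
  ultimately show thesis by (rule that)
qed

text \<open>Recursion is available only on naturals, so the partial sums are carried as codes of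
  rationals, with a computable function on codes in place of addition.\<close>

lemma computable_rat_sum:
  assumes "computable_rat (\<lambda>m. g (fst (prod_decode m)) (snd (prod_decode m)))" "computable k"
  shows "computable_rat (\<lambda>n. \<Sum>i<k n. g n i)"
proof -
  obtain c where c: "computable c"
    "\<And>m. rational_of_code (c m) = g (fst (prod_decode m)) (snd (prod_decode m))"
    using computable_rat_obtain_code[OF assms(1)] by blast
  have "computable_rat (\<lambda>m. rational_of_code (fst (prod_decode m)) + rational_of_code (snd (prod_decode m)))"
    by (intro computable_rat_add computable_rat_of_code computable_basic)
  from computable_rat_obtain_code[OF this] obtain plus where plus: "computable plus"
    "\<And>m. rational_of_code (plus m) = rational_of_code (fst (prod_decode m)) + rational_of_code (snd (prod_decode m))"
    by blast
  obtain zero where zero: "rational_of_code zero = 0"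
    using computable_rat_obtain_code[OF computable_rat_0] by metis
  define s where "s n b = rec_nat zero (\<lambda>i r. plus (prod_encode (r, c (prod_encode (n, i))))) b" for n b
  have "rational_of_code (s n b) = (\<Sum>i<b. g n i)" for n b
    by (induction b) (simp_all add: s_def zero plus c)
  moreover have "computable (\<lambda>n. s n (k n))"
    unfolding s_def
    by (intro computable_rec_nat computable_basic computable.comp[OF plus(1)] computable.comp[OF c(1)] assms(2))
  ultimately show ?thesis
    using computable_rat_of_code[of "\<lambda>n. s n (k n)"] by simp
qed

lemmas computable_rat_intros = computable_rat_0 computable_rat_1 computable_rat_numeral
  computable_rat_add computable_rat_mult computable_rat_uminus computable_rat_diff
  computable_rat_divide computable_rat_two_power computable_rat_if computable_rat_abs
  computable_rat_of_code computable_rat_of_nat decidable_rat_less decidable_rat_le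

subsection \<open>A Borel--Cantelli lemma for Schnorr randomness\<close>

text \<open>A half-open interval with endpoints on the grid contains every cell that it meets, which
  reduces the measure to a count of cells. The count asks only for comparisons of rationals and
  copes with overlapping intervals.\<close>

lemma measure_union_grid_intervals:
  fixes a b :: "'i \<Rightarrow> real" and T D :: nat
  assumes "finite I" and D: "D > 0"
    and int: "\<And>i. i \<in> I \<Longrightarrow> a i * D \<in> \<int>" "\<And>i. i \<in> I \<Longrightarrow> b i * D \<in> \<int>"
    and bound: "\<And>i. i \<in> I \<Longrightarrow> - real T \<le> a i" "\<And>i. i \<in> I \<Longrightarrow> b i \<le> real T"
  shows "measure lborel (\<Union>i\<in>I. {a i<..<b i}) =
    real (\<Sum>m<2 * T * D. of_bool (\<exists>i\<in>I. a i \<le> m / D - T \<and> Suc m / D - T \<le> b i)) / D"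
proof -
  define cell :: "nat \<Rightarrow> real set" where "cell m = {m / D - T..<Suc m / D - T}" for m
  define S where "S = {m. m < 2 * T * D \<and> (\<exists>i\<in>I. a i \<le> m / D - T \<and> Suc m / D - T \<le> b i)}"
  have [simp]: "finite S"
    by (rule finite_subset[of _ "{..<2 * T * D}"]) (auto simp: S_def)
  have cellI: "t \<in> cell (nat \<lfloor>(t + T) * D\<rfloor>)" if "- real T \<le> t" for t
  proof -
    define m where "m = nat \<lfloor>(t + T) * D\<rfloor>"
    have "0 \<le> (t + T) * D" using that by simp
    then have "real m \<le> (t + T) * D" "(t + T) * D < real m + 1"
      unfolding m_def by linarith+
    then show ?thesis
      using D unfolding cell_def m_def[symmetric] by (simp add: field_simps)
  qed
  have cell_eq: "m = nat \<lfloor>(t + T) * D\<rfloor>" if "t \<in> cell m" for t m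
  proof -
    have "real m \<le> (t + T) * D" "(t + T) * D < real m + 1"
      using that D unfolding cell_def by (simp_all add: field_simps)
    then have "\<lfloor>(t + T) * D\<rfloor> = int m" by linarith
    then show ?thesis by simp
  qed
  \<comment> \<open>Half-open intervals fit the cells exactly; the finitely many left endpoints by
    which they exceed the open ones form a null set.\<close>
  have "(\<Union>i\<in>I. {a i..<b i}) = (\<Union>m\<in>S. cell m)"
  proof (intro subset_antisym subsetI)
    fix t assume "t \<in> (\<Union>i\<in>I. {a i..<b i})"
    then obtain i where i: "i \<in> I" "a i \<le> t" "t < b i" by auto
    define m where "m = nat \<lfloor>(t + T) * D\<rfloor>"
    have "- real T \<le> t" "t < real T"
      using i bound[OF i(1)] by auto
    then have t: "t \<in> cell m"
      unfolding m_def by (intro cellI)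
    then have m: "real m \<le> (t + T) * D" "(t + T) * D < real m + 1"
      using D unfolding cell_def by (simp_all add: field_simps)
    obtain A B where AB: "a i * D = of_int A" "b i * D = of_int B"
      using int[OF i(1)] by (auto elim!: Ints_cases)
    have "a i * D \<le> t * D" "t * D < b i * D"
      using i D by auto
    then have "of_int A < real m + 1 - real (T * D)" "real m - real (T * D) < of_int B"
      using m AB by (simp_all add: algebra_simps)
    then have "A < int m + 1 - int (T * D)" "int m - int (T * D) < B"
      by linarith+
    \<comment> \<open>Here the grid condition enters: both sides are integers, so the strict bounds
      improve by one and the cell of \<open>t\<close> lies in the interval.\<close>
    then have "A \<le> int m - int (T * D)" "int m + 1 - int (T * D) \<le> B"
      by linarith+
    then have "of_int A \<le> real m - real (T * D)" "real m + 1 - real (T * D) \<le> of_int B"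
      by linarith+
    then have "a i \<le> m / D - T" "Suc m / D - T \<le> b i"
      using D by (simp_all add: field_simps flip: AB)
    moreover have "m < 2 * T * D"
    proof -
      have "real m < (real T + T) * D"
        using m(1) \<open>t < real T\<close> D
        by (meson add_strict_right_mono le_less_trans mult_strict_right_mono of_nat_0_less_iff)
      also have "\<dots> = real (2 * T * D)" by simp
      finally show ?thesis by (simp only: of_nat_less_iff)
    qed
    ultimately show "t \<in> (\<Union>m\<in>S. cell m)"
      using t i(1) by (auto simp: S_def)
  next
    fix t assume "t \<in> (\<Union>m\<in>S. cell m)"
    then obtain m i where "i \<in> I" "a i \<le> m / D - T" "Suc m / D - T \<le> b i" "t \<in> cell m"
      by (auto simp: S_def)
    then have "t \<in> {a i..<b i}"
      unfolding cell_def atLeastLessThan_iff by linarith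
    with \<open>i \<in> I\<close> show "t \<in> (\<Union>i\<in>I. {a i..<b i})"
      by blast
  qed
  moreover have "measure lborel (\<Union>m\<in>S. cell m) = (\<Sum>m\<in>S. measure lborel (cell m))"
  proof (rule measure_finite_Union)
    show "disjoint_family_on cell S"
      unfolding disjoint_family_on_def using cell_eq by blast
    show "emeasure lborel (cell m) \<noteq> \<infinity>" for m
      using emeasure_bounded_finite[of "cell m"] by (auto simp: cell_def)
  qed (auto simp: cell_def)
  moreover have "measure lborel (cell m) = 1 / D" for m
    using D by (simp add: cell_def field_simps)
  moreover have "measure lborel (\<Union>i\<in>I. {a i<..<b i}) = measure lborel (\<Union>i\<in>I. {a i..<b i})"
  proof (rule measure_eq_AE)
    have "AE t in lborel. t \<notin> a ` I"
      using assms(1) by (intro AE_not_in finite_imp_null_set_lborel) simp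
    then show "AE t in lborel. t \<in> (\<Union>i\<in>I. {a i<..<b i}) \<longleftrightarrow> t \<in> (\<Union>i\<in>I. {a i..<b i})"
      by eventually_elim (force simp: less_le)
  qed (use assms(1) in auto)
  moreover have "card S = (\<Sum>m<2 * T * D. of_bool (\<exists>i\<in>I. a i \<le> m / D - T \<and> Suc m / D - T \<le> b i))"
    by (simp add: S_def Int_def)
  ultimately show ?thesis by simp
qed

text \<open>The tail unions form a Schnorr test: their measures are limits of measures of finite
  unions, with an error controlled by a later tail. The single sequence \<open>T\<close> both bounds
  the intervals and gives the precision of their endpoints.\<close>

lemma schnorr_borel_cantelli:
  fixes a b :: "nat \<Rightarrow> nat \<Rightarrow> real"
  assumes x: "schnorr_random x"
    and a: "computable_rat (\<lambda>m. a (fst (prod_decode m)) (snd (prod_decode m)))"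
    and b: "computable_rat (\<lambda>m. b (fst (prod_decode m)) (snd (prod_decode m)))"
    and l: "computable l" and T: "computable T"
    and bound: "\<And>n i. i < l n \<Longrightarrow> - real (T n) \<le> a n i" "\<And>n i. i < l n \<Longrightarrow> b n i \<le> real (T n)"
    and int: "\<And>n i. i < l n \<Longrightarrow> a n i * 2 ^ T n \<in> \<int>" "\<And>n i. i < l n \<Longrightarrow> b n i * 2 ^ T n \<in> \<int>"
    and meas: "\<And>n. measure lborel (\<Union>i<l n. {a n i<..<b n i}) \<le> 2 ^ s / 2 ^ n"
  shows "\<exists>N. \<forall>n\<ge>N. \<forall>i<l n. x \<notin> {a n i<..<b n i}"
proof -
  define U where "U n = (\<Union>i<l n. {a n i<..<b n i})" for n
  \<comment> \<open>The shift by \<open>Suc s\<close> absorbs the constant \<open>2 ^ s\<close> and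
    the factor 2 of the geometric series.\<close>
  define V where "V k = (\<Union>n. U (k + Suc s + n))" for k
  define W where "W k M = (\<Union>n<M. U (k + Suc s + n))" for k M
  have [simp]: "U n \<in> sets borel" "V n \<in> sets borel" "W n M \<in> sets borel" for n M
    by (auto simp: U_def V_def W_def)
  have a': "computable e \<Longrightarrow> computable e' \<Longrightarrow> computable_rat (\<lambda>n. a (e n) (e' n))" for e e'
    using computable_rat_compose[OF a computable.pair[of e e']] by simp
  have b': "computable e \<Longrightarrow> computable e' \<Longrightarrow> computable_rat (\<lambda>n. b (e n) (e' n))" for e e'
    using computable_rat_compose[OF b computable.pair[of e e']] by simp

  have U_fin: "emeasure lborel (U n) = ennreal (measure lborel (U n))" for n
  proof (rule emeasure_eq_ennreal_measure)
    have "bounded (U n)" by (auto simp: U_def)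
    then show "emeasure lborel (U n) \<noteq> top"
      using emeasure_bounded_finite by fastforce
  qed
  have V_le: "emeasure lborel (V k) \<le> ennreal (1 / 2 ^ k)" for k
  proof -
    have sums: "(\<lambda>n. 1 / 2 ^ (k + Suc n)) sums (1 / 2 ^ k :: real)"
      using sums_mult[OF power_half_series, of "1 / 2 ^ k"]
      by (simp add: power_add power_one_over field_simps)
    have "emeasure lborel (V k) \<le> (\<Sum>n. emeasure lborel (U (k + Suc s + n)))"
      unfolding V_def by (rule emeasure_subadditive_countably) auto
    also have "\<dots> \<le> (\<Sum>n. ennreal (1 / 2 ^ (k + Suc n)))"
    proof (intro suminf_le)
      fix n
      have "2 ^ s / 2 ^ (k + Suc s + n) = (1 / 2 ^ (k + Suc n) :: real)"
        by (simp add: power_add field_simps)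
      then show "emeasure lborel (U (k + Suc s + n)) \<le> ennreal (1 / 2 ^ (k + Suc n))"
        using meas[of "k + Suc s + n"] unfolding U_fin U_def[symmetric] by (simp add: ennreal_leI)
    qed auto
    also have "\<dots> = ennreal (1 / 2 ^ k)"
      using sums by (intro suminf_ennreal_eq) auto
    finally show ?thesis .
  qed
  have V_fin: "emeasure lborel (V k) \<noteq> \<infinity>" for k
    using V_le[of k] by (auto simp: top_unique)
  have V_measure: "measure lborel (V k) \<le> 1 / 2 ^ k" for k
    using V_le[of k] V_fin[of k] by (simp add: emeasure_eq_ennreal_measure)
  \<comment> \<open>What \<open>W k M\<close> misses lies in the later tail
    \<open>V (k + M)\<close>, of measure at most \<open>1 / 2 ^ (k + M)\<close>.\<close>
  have W_approx: "\<bar>measure lborel (W k M) - measure lborel (V k)\<bar> \<le> 1 / 2 ^ M" for k M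
  proof -
    have "V k = W k M \<union> V (k + M)"
    proof (intro subset_antisym subsetI)
      fix t assume "t \<in> V k"
      then obtain n where n: "t \<in> U (k + Suc s + n)" by (auto simp: V_def)
      show "t \<in> W k M \<union> V (k + M)"
      proof (cases "n < M")
        case True
        then show ?thesis using n by (auto simp: W_def)
      next
        case False
        then have "k + Suc s + n = k + M + Suc s + (n - M)" by simp
        then have "t \<in> U (k + M + Suc s + (n - M))" using n by (simp only:)
        then show ?thesis unfolding V_def by blast
      qed
    next
      fix t assume "t \<in> W k M \<union> V (k + M)"
      then show "t \<in> V k"
      proof
        assume "t \<in> V (k + M)"
        then obtain n where "t \<in> U (k + M + Suc s + n)" unfolding V_def by blast
        then have "t \<in> U (k + Suc s + (M + n))" by (simp add: ac_simps)
        then show "t \<in> V k" unfolding V_def by blast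
      qed (auto simp: V_def W_def)
    qed
    moreover have "W k M \<subseteq> V k" by (auto simp: W_def V_def)
    moreover have W: "W k M \<in> fmeasurable lborel"
      using \<open>W k M \<subseteq> V k\<close> V_fin[of k]
      by (intro fmeasurableI) (auto simp: less_top dest: emeasure_mono[of _ _ lborel] intro: le_less_trans)
    moreover have V: "V j \<in> fmeasurable lborel" for j
      using V_fin[of j] by (intro fmeasurableI) (auto simp: less_top)
    ultimately have "measure lborel (V k) \<le> measure lborel (W k M) + measure lborel (V (k + M))"
      "measure lborel (W k M) \<le> measure lborel (V k)"
      by (metis fmeasurableD measure_Un_le) (use \<open>W k M \<subseteq> V k\<close> V in \<open>auto intro!: measure_mono_fmeasurable\<close>)
    moreover have "1 / 2 ^ (k + M) \<le> (1 / 2 ^ M :: real)"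
      by (simp add: power_add field_simps)
    ultimately show ?thesis using V_measure[of "k + M"] by linarith
  qed

  have "uniformly_effectively_open V"
  proof -
    define idx where "idx m = fst (prod_decode m) + Suc s + fst (prod_decode (snd (prod_decode m)))" for m
    define j where "j m = snd (prod_decode (snd (prod_decode m)))" for m
    have idx: "computable idx" and j: "computable j"
      unfolding idx_def j_def by (intro computable_intros)+
    \<comment> \<open>Both endpoints default to 0 for indices out of range, which codes the empty
      interval and merges the finite families into one total enumeration.\<close>
    have rat: "computable_rat (\<lambda>m. if j m < l (idx m) then a (idx m) (j m) else 0)"
      "computable_rat (\<lambda>m. if j m < l (idx m) then b (idx m) (j m) else 0)"
      by (intro computable_rat_intros a' b' idx j decidable_less computable.comp[OF l])+
    obtain c where c: "computable c"
      "\<And>m. rational_of_code (c m) = (if j m < l (idx m) then a (idx m) (j m) else 0)"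
      using computable_rat_obtain_code[OF rat(1)] by blast
    obtain c' where c': "computable c'"
      "\<And>m. rational_of_code (c' m) = (if j m < l (idx m) then b (idx m) (j m) else 0)"
      using computable_rat_obtain_code[OF rat(2)] by blast
    have "V k = (\<Union>i. interval_of_code (prod_encode (c (prod_encode (k, i)), c' (prod_encode (k, i)))))" for k
    proof (intro subset_antisym subsetI)
      fix t assume "t \<in> V k"
      then obtain n i where "i < l (k + Suc s + n)" "t \<in> {a (k + Suc s + n) i<..<b (k + Suc s + n) i}"
        by (auto simp: V_def U_def)
      then have "t \<in> interval_of_code (prod_encode (c (prod_encode (k, prod_encode (n, i))),
          c' (prod_encode (k, prod_encode (n, i)))))"
        by (simp add: interval_of_code_def c c' idx_def j_def)
      then show "t \<in> (\<Union>i. interval_of_code (prod_encode (c (prod_encode (k, i)), c' (prod_encode (k, i)))))"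
        by blast
    next
      fix t assume "t \<in> (\<Union>i. interval_of_code (prod_encode (c (prod_encode (k, i)), c' (prod_encode (k, i)))))"
      then show "t \<in> V k"
        by (force simp: interval_of_code_def c c' idx_def j_def V_def U_def split: if_splits)
    qed
    moreover have "computable (\<lambda>m. prod_encode (c m, c' m))"
      by (intro computable.pair c c')
    ultimately show ?thesis
      unfolding uniformly_effectively_open_def by blast
  qed
  moreover have "uniformly_computable_reals (\<lambda>k. measure lborel (V k))"
  proof -
    \<comment> \<open>A sum in place of a maximum, as sums are already known to be computable. It
      dominates \<open>T\<close> at every index occurring in \<open>W k M\<close>, so that all these
      intervals share one grid.\<close>
    define T' where "T' k M = (\<Sum>n<k + Suc s + M. T n)" for k M
    have T': "computable e \<Longrightarrow> computable e' \<Longrightarrow> computable (\<lambda>n. T' (e n) (e' n))" for e e'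
      unfolding T'_def by (intro computable_sum computable_intros computable.comp[OF T])
    define count where "count k M = (\<Sum>m<2 * T' k M * 2 ^ T' k M. of_bool (\<exists>n<M. \<exists>i<l (k + Suc s + n).
        a (k + Suc s + n) i \<le> real m / 2 ^ T' k M - real (T' k M) \<and>
        real (Suc m) / 2 ^ T' k M - real (T' k M) \<le> b (k + Suc s + n) i) :: nat)" for k M
    have "measure lborel (W k M) = real (count k M) / 2 ^ T' k M" for k M
    proof -
      define I where "I = Sigma {..<M} (\<lambda>n. {..<l (k + Suc s + n)})"
      have T'_ge: "T (k + Suc s + n) \<le> T' k M" if "n < M" for n
        unfolding T'_def using that by (intro member_le_sum) auto
      have int': "r * 2 ^ T' k M \<in> \<int>" if "r * 2 ^ T (k + Suc s + n) \<in> \<int>" "n < M" for r :: real and n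
      proof -
        have "2 ^ T' k M = (2 ^ T (k + Suc s + n) * 2 ^ (T' k M - T (k + Suc s + n)) :: real)"
          using T'_ge[OF that(2)] by (simp flip: power_add)
        then have "r * 2 ^ T' k M = r * 2 ^ T (k + Suc s + n) * 2 ^ (T' k M - T (k + Suc s + n))"
          by simp
        then show ?thesis
          using that(1) by (metis Ints_mult Ints_numeral Ints_power)
      qed
      have W_eq: "W k M = (\<Union>p\<in>I. {a (k + Suc s + fst p) (snd p)<..<b (k + Suc s + fst p) (snd p)})"
        by (auto simp: W_def U_def I_def Bex_def) blast
      have "measure lborel (W k M) =
        real (\<Sum>m<2 * T' k M * 2 ^ T' k M. of_bool (\<exists>p\<in>I. a (k + Suc s + fst p) (snd p) \<le> m / (2 ^ T' k M :: nat) - T' k M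
          \<and> Suc m / (2 ^ T' k M :: nat) - T' k M \<le> b (k + Suc s + fst p) (snd p))) / (2 ^ T' k M :: nat)"
        unfolding W_eq
      proof (rule measure_union_grid_intervals)
        show "- real (T' k M) \<le> a (k + Suc s + fst p) (snd p)" if "p \<in> I" for p
        proof -
          have "- real (T (k + Suc s + fst p)) \<le> a (k + Suc s + fst p) (snd p)"
            using that by (intro bound) (auto simp: I_def)
          then show ?thesis using T'_ge[of "fst p"] that by (auto simp: I_def)
        qed
        show "b (k + Suc s + fst p) (snd p) \<le> real (T' k M)" if "p \<in> I" for p
        proof -
          have "b (k + Suc s + fst p) (snd p) \<le> real (T (k + Suc s + fst p))"
            using that by (intro bound) (auto simp: I_def)
          then show ?thesis using T'_ge[of "fst p"] that by (auto simp: I_def)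
        qed
        show "a (k + Suc s + fst p) (snd p) * real (2 ^ T' k M) \<in> \<int>" if "p \<in> I" for p
          using int'[OF int(1)[of "snd p"], of "fst p"] that by (auto simp: I_def)
        show "b (k + Suc s + fst p) (snd p) * real (2 ^ T' k M) \<in> \<int>" if "p \<in> I" for p
          using int'[OF int(2)[of "snd p"], of "fst p"] that by (auto simp: I_def)
      qed (auto simp: I_def)
      also have "\<dots> = real (count k M) / 2 ^ T' k M"
      proof -
        have "(\<exists>p\<in>I. P (fst p) (snd p)) \<longleftrightarrow> (\<exists>n<M. \<exists>i<l (k + Suc s + n). P n i)" for P
          by (auto simp: I_def)
        from this[of "\<lambda>n i. a (k + Suc s + n) i \<le> _ \<and> _ \<le> b (k + Suc s + n) i"] show ?thesis
          unfolding count_def by simp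
      qed
      finally show ?thesis .
    qed
    moreover have rat: "computable_rat (\<lambda>m. real (count (fst (prod_decode m)) (snd (prod_decode m))) /
        2 ^ T' (fst (prod_decode m)) (snd (prod_decode m)))"
      unfolding count_def
      by (intro computable_rat_intros computable_sum computable_of_bool decidable_bex decidable_conj
          T' a' b' computable.comp[OF l] computable_intros)
    obtain q where "computable q" "\<And>m. rational_of_code (q m) =
        real (count (fst (prod_decode m)) (snd (prod_decode m))) /
        2 ^ T' (fst (prod_decode m)) (snd (prod_decode m))"
      using computable_rat_obtain_code[OF rat] by blast
    ultimately show ?thesis
      using W_approx unfolding uniformly_computable_reals_def
      by (intro exI[of _ q]) simp
  qed
  ultimately have "schnorr_test V"
    using V_le by (simp add: schnorr_test_def)
  then obtain k where k: "x \<notin> V k"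
    using x unfolding schnorr_random_def by blast
  have "x \<notin> U n" if "n \<ge> k + Suc s" for n
    using k that unfolding V_def by (metis UN_I UNIV_I le_iff_add)
  then show ?thesis
    by (auto simp: U_def)
qed

subsection \<open>Piecewise linear functions given by codes\<close>

lemma abs_int_decode_le: "\<bar>int_decode n\<bar> \<le> int n"
  by (auto simp: int_decode_def sum_decode_def elim!: oddE evenE)

lemma rational_of_code_quotient:
  obtains z d :: int where "rational_of_code n = real_of_int z / real_of_int d"
    "0 < d" "d \<le> int n + 1" "\<bar>z\<bar> \<le> int n"
proof -
  obtain i j where ij: "prod_decode n = (i, j)" by fastforce
  then have "n = prod_encode (i, j)" by (metis prod_decode_inverse)
  then have "\<bar>int_decode i\<bar> \<le> int n" "\<bar>int_decode j\<bar> \<le> int n"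
    using abs_int_decode_le[of i] abs_int_decode_le[of j] le_prod_encode_1[of i j] le_prod_encode_2[of j i]
    by linarith+
  then show thesis
    \<comment> \<open>The instance \<open>0 / 1\<close> serves a zero denominator, where the
      quotient is 0 by convention; it accounts for the \<open>+ 1\<close> in the bound on
      \<open>d\<close>.\<close>
    using that[of "int_decode i" "int_decode j"] that[of "- int_decode i" "- int_decode j"] that[of 0 1]
    by (cases "int_decode j" "0 :: int" rule: linorder_cases) (auto simp: rational_of_code_eq ij)
qed

lemma abs_rational_of_code_le: "\<bar>rational_of_code n\<bar> \<le> real n"
proof (rule rational_of_code_quotient[of n])
  fix z d :: int
  assume *: "rational_of_code n = real_of_int z / real_of_int d" "0 < d" "\<bar>z\<bar> \<le> int n"
  then have "\<bar>real_of_int z\<bar> \<le> real n" "1 \<le> real_of_int d" by linarith+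
  then have "\<bar>real_of_int z\<bar> \<le> real n * real_of_int d"
    by (smt (verit) mult_left_le_one_le mult_le_cancel_left1 of_nat_0_le_iff)
  then show ?thesis
    using *(2) unfolding *(1) by (simp add: pos_divide_le_eq)
qed

text \<open>Distinct fractions differ by at least the reciprocal of the product of their
  denominators, which are at most \<open>c + 1\<close>. This is how a code alone controls the slopes
  of its function.\<close>

lemma rational_of_code_separation:
  assumes "m \<le> c" "n \<le> c" "rational_of_code m < rational_of_code n"
  shows "1 \<le> (real c + 1)\<^sup>2 * (rational_of_code n - rational_of_code m)"
proof (rule rational_of_code_quotient[of m], rule rational_of_code_quotient[of n])
  fix z d z' d' :: int
  assume m: "rational_of_code m = real_of_int z / real_of_int d" "0 < d" "d \<le> int m + 1"
    and n: "rational_of_code n = real_of_int z' / real_of_int d'" "0 < d'" "d' \<le> int n + 1"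
  have "real_of_int (d * d') * (rational_of_code n - rational_of_code m) = real_of_int (z' * d - z * d')"
    using m n by (simp add: field_simps)
  moreover have "0 < real_of_int (d * d') * (rational_of_code n - rational_of_code m)"
    using m n assms by simp
  ultimately have "1 \<le> real_of_int (d * d') * (rational_of_code n - rational_of_code m)"
    by (simp only: of_int_0_less_iff of_int_1_le_iff)
  also have "\<dots> \<le> (real c + 1)\<^sup>2 * (rational_of_code n - rational_of_code m)"
  proof (rule mult_right_mono)
    have "d \<le> int c + 1" "d' \<le> int c + 1"
      using m n assms by linarith+
    then have "d * d' \<le> (int c + 1) * (int c + 1)"
      using m n by (intro mult_mono) auto
    then have "real_of_int (d * d') \<le> real_of_int ((int c + 1) * (int c + 1))"
      by (simp only: of_int_le_iff)
    then show "real_of_int (d * d') \<le> (real c + 1)\<^sup>2"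
      by (simp add: power2_eq_square)
  qed (use assms in simp)
  finally show ?thesis .
qed

lemma list_decode_member_le: "j \<in> set (list_decode c) \<Longrightarrow> j \<le> c"
proof (induction c rule: less_induct)
  case (less c)
  show ?case
  proof (cases c)
    case 0
    then show ?thesis using less by simp
  next
    case (Suc n)
    obtain i k where ik: "prod_decode n = (i, k)" by fastforce
    then have "n = prod_encode (i, k)" by (metis prod_decode_inverse)
    then have "i \<le> n" "k \<le> n"
      using le_prod_encode_1 le_prod_encode_2 by auto
    then show ?thesis
      using less.IH[of k] less.prems Suc ik by auto
  qed
qed

lemma length_list_decode_le: "length (list_decode c) \<le> c"
proof (induction c rule: less_induct)
  case (less c)
  show ?case
  proof (cases c)
    case (Suc n)
    obtain i k where ik: "prod_decode n = (i, k)" by fastforce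
    then have "n = prod_encode (i, k)" by (metis prod_decode_inverse)
    then have "k \<le> n"
      using le_prod_encode_2 by auto
    then show ?thesis
      using less.IH[of k] Suc ik by auto
  qed simp
qed

lemma vertex_of_codeE:
  assumes "p \<in> set (vertices_of_code c)"
  obtains i j where "p = (rational_of_code i, rational_of_code j)" "i \<le> c" "j \<le> c"
proof -
  obtain n where n: "n \<in> set (list_decode c)"
    "p = (case prod_decode n of (a, b) \<Rightarrow> (rational_of_code a, rational_of_code b))"
    using assms by (auto simp: vertices_of_code_def)
  obtain i j where ij: "prod_decode n = (i, j)" by fastforce
  then have "n = prod_encode (i, j)" by (metis prod_decode_inverse)
  then have "i \<le> c" "j \<le> c"
    using list_decode_member_le[OF n(1)] le_prod_encode_1[of i j] le_prod_encode_2[of j i] by auto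
  then show thesis using that n ij by auto
qed

text \<open>Ordinates differ by at most \<open>2 * c\<close> and distinct abscissae by at least
  \<open>1 / (c + 1)^2\<close> when the codes involved are at most \<open>c\<close>.\<close>

definition vertex_slope_bound :: "nat \<Rightarrow> real" where
  "vertex_slope_bound c = 2 * real c * (real c + 1)\<^sup>2"

lemma vertex_slope_bound_nonneg: "0 \<le> vertex_slope_bound c"
  by (simp add: vertex_slope_bound_def)

lemma vertices_of_code_slope:
  assumes "p \<in> set (vertices_of_code c)" "q \<in> set (vertices_of_code c)" "fst p < fst q"
  shows "\<bar>snd q - snd p\<bar> \<le> vertex_slope_bound c * (fst q - fst p)"
proof -
  obtain i j where p: "p = (rational_of_code i, rational_of_code j)" "i \<le> c" "j \<le> c"
    using vertex_of_codeE[OF assms(1)] .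
  obtain i' j' where q: "q = (rational_of_code i', rational_of_code j')" "i' \<le> c" "j' \<le> c"
    using vertex_of_codeE[OF assms(2)] .
  have "\<bar>snd q - snd p\<bar> \<le> 2 * real c"
    using abs_rational_of_code_le[of j] abs_rational_of_code_le[of j'] p q by (simp add: abs_le_iff)
  also have "\<dots> \<le> 2 * real c * ((real c + 1)\<^sup>2 * (fst q - fst p))"
    using rational_of_code_separation[of i c i'] p q assms(3) by (intro mult_le_cancel_left1[THEN iffD2]) auto
  finally show ?thesis by (simp add: vertex_slope_bound_def mult_ac)
qed

text \<open>Induction along the list: the first segment has slope at most \<open>L\<close>, and the
  two estimates are chained through the vertex between it and the rest. The value at the first
  vertex is carried along to glue the pieces; at the end of the list it must be 0, because the
  interpolation of a single vertex is 0.\<close>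

lemma piecewise_linear_lipschitz_right:
  assumes "sorted_wrt (<) (map fst ps)" "ps \<noteq> []" "snd (last ps) = 0" "0 \<le> L"
    and "\<And>p q. p \<in> set ps \<Longrightarrow> q \<in> set ps \<Longrightarrow> fst p < fst q \<Longrightarrow> \<bar>snd q - snd p\<bar> \<le> L * (fst q - fst p)"
  shows "piecewise_linear ps (fst (hd ps)) = snd (hd ps) \<and>
    (\<forall>x y. fst (hd ps) \<le> x \<longrightarrow> x \<le> y \<longrightarrow> \<bar>piecewise_linear ps y - piecewise_linear ps x\<bar> \<le> L * (y - x))"
  using assms
proof (induction ps)
  case (Cons p ps)
  obtain a u where p: "p = (a, u)" by fastforce
  show ?case
  proof (cases ps)
    case Nil
    then show ?thesis using Cons.prems p by simp
  next
    case (Cons q qs)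
    obtain b v where q: "q = (b, v)" by fastforce
    let ?P = "piecewise_linear (p # ps)" and ?Q = "piecewise_linear ps"
    have ab: "a < b" using Cons.prems(1) Cons p q by simp
    have "?Q (fst (hd ps)) = snd (hd ps) \<and>
      (\<forall>x y. fst (hd ps) \<le> x \<longrightarrow> x \<le> y \<longrightarrow> \<bar>?Q y - ?Q x\<bar> \<le> L * (y - x))"
    proof (rule Cons.IH)
      show "\<And>p q. p \<in> set ps \<Longrightarrow> q \<in> set ps \<Longrightarrow> fst p < fst q \<Longrightarrow> \<bar>snd q - snd p\<bar> \<le> L * (fst q - fst p)"
        using Cons.prems(5) by simp
    qed (use Cons.prems Cons in auto)
    then have IH: "?Q b = v" "\<And>x y. b \<le> x \<Longrightarrow> x \<le> y \<Longrightarrow> \<bar>?Q y - ?Q x\<bar> \<le> L * (y - x)"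
      using Cons q by auto
    define s where "s = (v - u) / (b - a)"
    have left: "?P x = u + s * (x - a)" if "a \<le> x" "x \<le> b" for x
      using that p q Cons by (simp add: s_def)
    have Pb: "?P b = v" using left[of b] ab by (simp add: s_def)
    have right: "?P x = ?Q x" if "b \<le> x" for x
    proof (cases "x = b")
      case False
      then show ?thesis using that p q Cons ab by simp
    qed (use Pb IH in simp)
    have slope: "\<bar>s\<bar> \<le> L"
      using Cons.prems(5)[of p q] p q Cons ab by (simp add: s_def pos_divide_le_eq)
    have left_lip: "\<bar>?P y - ?P x\<bar> \<le> L * (y - x)" if "a \<le> x" "x \<le> y" "y \<le> b" for x y
    proof -
      have "?P y - ?P x = s * (y - x)"
        using left[of x] left[of y] that by (simp add: right_diff_distrib)
      then have "\<bar>?P y - ?P x\<bar> = \<bar>s\<bar> * (y - x)"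
        using that by (simp add: abs_mult)
      then show ?thesis using slope that by (simp add: mult_right_mono)
    qed
    have right_lip: "\<bar>?P y - ?P x\<bar> \<le> L * (y - x)" if "b \<le> x" "x \<le> y" for x y
      using that IH(2)[of x y] right by simp
    have "\<bar>?P y - ?P x\<bar> \<le> L * (y - x)" if "a \<le> x" "x \<le> y" for x y
    proof (cases "b \<le> x \<or> y \<le> b")
      case False
      then show ?thesis
        using left_lip[of x b] right_lip[of b y] that by (simp add: algebra_simps)
    qed (use left_lip right_lip that in blast)
    then show ?thesis using p left[of a] ab by simp
  qed
qed simp

lemma piecewise_linear_eq_0_left:
  "\<forall>p\<in>set ps. x < fst p \<Longrightarrow> piecewise_linear ps x = 0"
  by (induction ps x rule: piecewise_linear.induct) auto

lemma piecewise_linear_eq_0_right: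
  "\<forall>p\<in>set ps. fst p < x \<Longrightarrow> piecewise_linear ps x = 0"
  by (induction ps x rule: piecewise_linear.induct) auto

text \<open>To the left of the first vertex the function is 0, which is also its value at that
  vertex, so the one-sided estimate extends across it.\<close>

lemma piecewise_linear_lipschitz:
  assumes "vertex_list ps" "0 \<le> L"
    and "\<And>p q. p \<in> set ps \<Longrightarrow> q \<in> set ps \<Longrightarrow> fst p < fst q \<Longrightarrow> \<bar>snd q - snd p\<bar> \<le> L * (fst q - fst p)"
  shows "\<bar>piecewise_linear ps x - piecewise_linear ps y\<bar> \<le> L * \<bar>x - y\<bar>"
proof (cases "ps = []")
  case True
  then show ?thesis using assms(2) by simp
next
  case False
  define a where "a = fst (hd ps)"
  have "piecewise_linear ps a = 0"
    and right: "\<And>x y. a \<le> x \<Longrightarrow> x \<le> y \<Longrightarrow> \<bar>piecewise_linear ps y - piecewise_linear ps x\<bar> \<le> L * (y - x)"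
    using piecewise_linear_lipschitz_right[OF _ False _ assms(2,3)] assms(1) False
    unfolding vertex_list_def a_def by auto
  moreover have "\<forall>p\<in>set ps. a \<le> fst p"
    using assms(1) False unfolding vertex_list_def a_def by (cases ps) auto
  ultimately have left: "piecewise_linear ps x = 0" if "x \<le> a" for x
    using that piecewise_linear_eq_0_left[of ps x] by (cases "x = a") fastforce+
  have *: "\<bar>piecewise_linear ps y - piecewise_linear ps x\<bar> \<le> L * (y - x)" if "x \<le> y" for x y
  proof -
    consider "a \<le> x" | "x < a" "a \<le> y" | "y < a" by linarith
    then show ?thesis
    proof cases
      case 2
      then have "\<bar>piecewise_linear ps y - piecewise_linear ps x\<bar> \<le> L * (y - a)"
        using right[of a y] left[of x] left[of a] by simp
      also have "\<dots> \<le> L * (y - x)"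
        using 2 assms(2) by (intro mult_left_mono) auto
      finally show ?thesis .
    qed (use that right left assms(2) in auto)
  qed
  show ?thesis
    using *[of x y] *[of y x] by (cases "x \<le> y") (auto simp: abs_minus_commute)
qed

lemma piecewise_linear_code_lipschitz:
  assumes "vertex_list (vertices_of_code c)"
  shows "\<bar>piecewise_linear (vertices_of_code c) x - piecewise_linear (vertices_of_code c) y\<bar>
    \<le> vertex_slope_bound c * \<bar>x - y\<bar>"
  by (intro piecewise_linear_lipschitz assms vertex_slope_bound_nonneg vertices_of_code_slope)

lemma piecewise_linear_code_support:
  assumes "real c < \<bar>x\<bar>"
  shows "piecewise_linear (vertices_of_code c) x = 0"
proof -
  have *: "\<bar>fst p\<bar> \<le> real c" if "p \<in> set (vertices_of_code c)" for p
    using that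
  proof (rule vertex_of_codeE)
    fix i j assume "p = (rational_of_code i, rational_of_code j)" "i \<le> c"
    then show ?thesis using abs_rational_of_code_le[of i] by simp
  qed
  show ?thesis
  proof (cases "x < 0")
    case True
    then have "\<forall>p\<in>set (vertices_of_code c). x < fst p"
      using * assms by (force simp: abs_le_iff)
    then show ?thesis by (rule piecewise_linear_eq_0_left)
  next
    case False
    then have "\<forall>p\<in>set (vertices_of_code c). fst p < x"
      using * assms by (force simp: abs_le_iff)
    then show ?thesis by (rule piecewise_linear_eq_0_right)
  qed
qed

text \<open>Segments open on the left and closed on the right are disjoint, so the interpolation is
  a plain sum of the first segments of all tails of the list. This replaces the list recursion of
  \<open>piecewise_linear\<close> by a bounded sum over codes.\<close>

fun first_segment :: "(real \<times> real) list \<Rightarrow> real \<Rightarrow> real" where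
  "first_segment ((a, u) # (b, v) # ps) x =
     (if a < x \<and> x \<le> b then u + (v - u) * (x - a) / (b - a) else 0)"
| "first_segment _ x = 0"

lemma first_segment_eq_0_left:
  "\<forall>p\<in>set ps. x \<le> fst p \<Longrightarrow> first_segment ps x = 0"
  by (induction ps x rule: first_segment.induct) auto

lemma sum_first_segment_eq_0_left:
  assumes "\<forall>p\<in>set ps. x \<le> fst p"
  shows "(\<Sum>i<k. first_segment (drop i ps) x) = 0"
  using assms by (intro sum.neutral ballI first_segment_eq_0_left) (auto dest: in_set_dropD)

text \<open>The first vertex is excluded because no left-open segment contains it. In the induction
  either \<open>x\<close> is at most the second abscissa and all later segments vanish, or it lies
  beyond and the first one does. The slack in \<open>k\<close> admits the code itself as the number
  of summands.\<close>

lemma piecewise_linear_eq_sum_segments: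
  assumes "sorted_wrt (<) (map fst ps)" "length ps \<le> k" "ps \<noteq> []" "x \<noteq> fst (hd ps)"
  shows "piecewise_linear ps x = (\<Sum>i<k. first_segment (drop i ps) x)"
  using assms
proof (induction ps x arbitrary: k rule: piecewise_linear.induct)
  case (1 a u b v ps x)
  obtain k' where k: "k = Suc k'" using 1 by (cases k) auto
  have split: "(\<Sum>i<k. first_segment (drop i ((a, u) # (b, v) # ps)) x) =
     first_segment ((a, u) # (b, v) # ps) x + (\<Sum>i<k'. first_segment (drop i ((b, v) # ps)) x)"
    unfolding k sum.lessThan_Suc_shift by simp
  show ?case
  proof (cases "x \<le> b")
    case True
    have "(\<Sum>i<k'. first_segment (drop i ((b, v) # ps)) x) = 0"
      using 1 True by (intro sum_first_segment_eq_0_left) auto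
    then show ?thesis using 1 True unfolding split by auto
  next
    case False
    then have "piecewise_linear ((b, v) # ps) x = (\<Sum>i<k'. first_segment (drop i ((b, v) # ps)) x)"
      using 1 k by (intro "1.IH") auto
    then show ?thesis using 1 False unfolding split by auto
  qed
next
  case ("2_2" w x)
  have "first_segment (drop i [w]) x = 0" for i
    by (cases i; cases w) auto
  then show ?case by simp
qed simp

lemma vertex_list_piecewise_linear_eq_sum:
  assumes "vertex_list ps" "length ps \<le> k"
  shows "piecewise_linear ps x = (\<Sum>i<k. first_segment (drop i ps) x)"
proof (cases "ps \<noteq> [] \<and> x = fst (hd ps)")
  case True
  then obtain p qs where ps: "ps = p # qs" by (cases ps) auto
  have "\<forall>p\<in>set ps. x \<le> fst p"
    using True assms(1) ps by (auto simp: vertex_list_def)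
  moreover have "piecewise_linear ps x = 0"
    using True assms(1) ps by (cases p; cases qs) (auto simp: vertex_list_def)
  ultimately show ?thesis using sum_first_segment_eq_0_left by metis
next
  case False
  then show ?thesis
    using piecewise_linear_eq_sum_segments[of ps k x] assms by (cases "ps = []") (auto simp: vertex_list_def)
qed

text \<open>A nonempty list has as its code the successor of the paired codes of head and tail. The
  code 0 of the empty list is its own tail, as \<open>prod_decode 0\<close> is
  \<open>(0, 0)\<close>, so iterating past the end is harmless.\<close>

definition code_tail :: "nat \<Rightarrow> nat" where
  "code_tail c = snd (prod_decode (c - 1))"

lemma prod_decode_0: "prod_decode 0 = (0, 0)"
  by (simp add: prod_decode_def prod_decode_aux.simps)

lemma vertices_of_code_0: "vertices_of_code 0 = []"
  by (simp add: vertices_of_code_def)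

lemma vertices_of_code_Cons:
  assumes "c \<noteq> 0"
  shows "vertices_of_code c =
    (rational_of_code (fst (prod_decode (fst (prod_decode (c - 1))))),
     rational_of_code (snd (prod_decode (fst (prod_decode (c - 1)))))) # vertices_of_code (code_tail c)"
  using assms by (cases c) (auto simp: vertices_of_code_def code_tail_def split: prod.split)

lemma vertices_of_code_tail: "vertices_of_code (code_tail c) = tl (vertices_of_code c)"
  by (cases "c = 0") (simp_all add: vertices_of_code_0 vertices_of_code_Cons[of c] code_tail_def prod_decode_0)

lemma vertices_of_code_tails: "vertices_of_code ((code_tail ^^ i) c) = drop i (vertices_of_code c)"
  by (induction i) (simp_all add: vertices_of_code_tail drop_Suc tl_drop)

text \<open>Puts the evaluation of a segment into arithmetic of codes, to which the closure
  properties apply. The condition \<open>0 < code_tail c\<close> says that a second vertex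
  exists.\<close>

lemma first_segment_code:
  fixes c :: nat
  defines "p \<equiv> fst (prod_decode (c - 1))" and "q \<equiv> fst (prod_decode (code_tail c - 1))"
  defines "a \<equiv> rational_of_code (fst (prod_decode p))" and "u \<equiv> rational_of_code (snd (prod_decode p))"
  defines "b \<equiv> rational_of_code (fst (prod_decode q))" and "v \<equiv> rational_of_code (snd (prod_decode q))"
  shows "first_segment (vertices_of_code c) x =
    (if 0 < code_tail c \<and> a < x \<and> x \<le> b then u + (v - u) * (x - a) / (b - a) else 0)"
proof (cases "c = 0 \<or> code_tail c = 0")
  case True
  then show ?thesis
  proof
    assume "c = 0"
    then show ?thesis by (simp add: vertices_of_code_0 code_tail_def prod_decode_0)
  next
    assume "code_tail c = 0"
    then show ?thesis
      by (cases "c = 0") (simp_all add: vertices_of_code_0 vertices_of_code_Cons[of c])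
  qed
next
  case False
  then have "vertices_of_code c = (a, u) # (b, v) # vertices_of_code (code_tail (code_tail c))"
    unfolding assms by (metis vertices_of_code_Cons)
  then show ?thesis using False by simp
qed

lemma computable_rat_piecewise_linear:
  assumes c: "computable c" and X: "computable_rat X"
    and vl: "\<And>n. vertex_list (vertices_of_code (c n))"
  shows "computable_rat (\<lambda>n. piecewise_linear (vertices_of_code (c n)) (X n))"
proof -
  have t: "computable e \<Longrightarrow> computable (\<lambda>n. code_tail (e n))" for e
    unfolding code_tail_def by (intro computable_intros)
  have t': "computable e \<Longrightarrow> computable i \<Longrightarrow> computable (\<lambda>n. (code_tail ^^ i n) (e n))" for e i
    by (intro computable_funpow t computable_intros)
  have seg: "computable_rat (\<lambda>n. first_segment (vertices_of_code (e n)) (Y n))"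
    if "computable e" "computable_rat Y" for e Y
    unfolding first_segment_code
    by (intro computable_rat_intros decidable_conj computable_intros t that)
  \<comment> \<open>A list has at most as many entries as its code, so \<open>c n\<close> summands
    suffice.\<close>
  have "piecewise_linear (vertices_of_code (c n)) (X n) =
      (\<Sum>i<c n. first_segment (vertices_of_code ((code_tail ^^ i) (c n))) (X n))" for n
    unfolding vertices_of_code_tails
    by (intro vertex_list_piecewise_linear_eq_sum vl)
      (simp add: vertices_of_code_def length_list_decode_le)
  moreover have "computable_rat (\<lambda>n. \<Sum>i<c n. first_segment (vertices_of_code ((code_tail ^^ i) (c n))) (X n))"
    by (intro computable_rat_sum seg t' computable.comp[OF c] computable_rat_compose[OF X] computable_intros c)
  ultimately show ?thesis by simp
qed

subsection \<open>Poisson integrals\<close>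

lemma borel_measurable_poisson_kernel [measurable]: "poisson_kernel y \<in> borel_measurable borel"
  unfolding poisson_kernel_def by measurable

lemma poisson_kernel_nonneg: "0 < y \<Longrightarrow> 0 \<le> poisson_kernel y s"
  by (simp add: poisson_kernel_def)

lemma poisson_kernel_le:
  assumes "0 < y"
  shows "poisson_kernel y s \<le> 1 / (pi * y)"
proof -
  have "y / (s\<^sup>2 + y\<^sup>2) \<le> y / y\<^sup>2"
    using assms by (intro divide_left_mono) (auto intro!: mult_pos_pos add_nonneg_pos)
  then have "1 / pi * (y / (s\<^sup>2 + y\<^sup>2)) \<le> 1 / pi * (y / y\<^sup>2)"
    by (intro mult_left_mono) auto
  then show ?thesis
    using assms by (simp add: poisson_kernel_def power2_eq_square)
qed

lemma borel_measurable_poisson_kernel_lebesgue: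
  "(\<lambda>t. poisson_kernel y (x - t)) \<in> borel_measurable lebesgue"
  by (intro measurable_completion) measurable

lemma integrable_poisson_kernel_mult:
  fixes f :: "real \<Rightarrow> real"
  assumes "integrable lebesgue f" "0 < y"
  shows "integrable lebesgue (\<lambda>t. poisson_kernel y (x - t) * f t)"
proof (rule Bochner_Integration.integrable_bound)
  show "integrable lebesgue (\<lambda>t. 1 / (pi * y) * f t)"
    using assms by simp
  show "(\<lambda>t. poisson_kernel y (x - t) * f t) \<in> borel_measurable lebesgue"
    using borel_measurable_poisson_kernel_lebesgue borel_measurable_integrable[OF assms(1)]
    by (rule borel_measurable_times)
  show "AE t in lebesgue. norm (poisson_kernel y (x - t) * f t) \<le> norm (1 / (pi * y) * f t)"
    using poisson_kernel_le[OF assms(2)] poisson_kernel_nonneg[OF assms(2)] assms(2)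
    by (intro AE_I2) (simp add: abs_mult mult_right_mono del: times_divide_eq_left)
qed

lemma poisson_integral_diff:
  fixes f :: "real \<Rightarrow> real"
  assumes "integrable lebesgue f" "integrable lebesgue g" "0 < y"
  shows "poisson_integral (\<lambda>t. f t - g t) x y = poisson_integral f x y - poisson_integral g x y"
  unfolding poisson_integral_def right_diff_distrib
  by (intro Bochner_Integration.integral_diff integrable_poisson_kernel_mult assms)

lemma abs_poisson_integral_le:
  assumes "0 < y"
  shows "\<bar>poisson_integral f x y\<bar> \<le> poisson_integral (\<lambda>t. \<bar>f t\<bar>) x y"
proof -
  have "\<bar>poisson_integral f x y\<bar> \<le> (LINT t|lebesgue. \<bar>poisson_kernel y (x - t) * f t\<bar>)"
    unfolding poisson_integral_def by (rule integral_abs_bound)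
  then show ?thesis
    using poisson_kernel_nonneg[OF assms] by (simp add: poisson_integral_def abs_mult)
qed

lemma poisson_integral_le_L1:
  fixes f :: "real \<Rightarrow> real"
  assumes "integrable lebesgue f" "0 < y"
  shows "\<bar>poisson_integral f x y\<bar> \<le> 1 / (pi * y) * (LINT t|lebesgue. \<bar>f t\<bar>)"
proof -
  have "poisson_integral (\<lambda>t. \<bar>f t\<bar>) x y \<le> (LINT t|lebesgue. 1 / (pi * y) * \<bar>f t\<bar>)"
    unfolding poisson_integral_def
    using poisson_kernel_le[OF assms(2)] assms
    by (intro integral_mono integrable_poisson_kernel_mult mult_right_mono) auto
  then show ?thesis
    using abs_poisson_integral_le[OF assms(2), of f x] by simp
qed

lemma poisson_integral_lborel:
  assumes [measurable]: "H \<in> borel_measurable borel"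
  shows "poisson_integral H x y = (LINT t|lborel. poisson_kernel y (x - t) * H t)"
  unfolding poisson_integral_def by (intro integral_completion) measurable

text \<open>Take the least \<open>k\<close> with \<open>\<bar>s\<bar> \<le> 2 ^ k * y\<close>. If it
  is 0, the maximum of the kernel suffices; otherwise \<open>\<bar>s\<bar>\<close> exceeds half of
  \<open>2 ^ k * y\<close>, which costs the factor 4. The other summands are nonnegative.\<close>

lemma poisson_kernel_le_dyadic_sum:
  assumes "0 < y" "\<bar>s\<bar> \<le> 2 ^ K * y"
  shows "poisson_kernel y s \<le> (\<Sum>k\<le>K. 4 / (pi * y * 4 ^ k) * of_bool (\<bar>s\<bar> \<le> 2 ^ k * y))"
proof -
  define k where "k = (LEAST k. \<bar>s\<bar> \<le> 2 ^ k * y)"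
  have k: "\<bar>s\<bar> \<le> 2 ^ k * y" "k \<le> K"
    unfolding k_def using assms(2) by (rule LeastI, rule Least_le)
  have "poisson_kernel y s \<le> 4 / (pi * y * 4 ^ k)"
  proof (cases k)
    case 0
    have "1 / (pi * y) \<le> 4 / (pi * y)"
      using assms by (intro divide_right_mono) auto
    then show ?thesis
      using poisson_kernel_le[OF assms(1), of s] 0 by simp
  next
    case (Suc j)
    then have "\<not> \<bar>s\<bar> \<le> 2 ^ j * y"
      unfolding k_def using not_less_Least by (metis lessI)
    then have "(2 ^ j * y)\<^sup>2 \<le> \<bar>s\<bar>\<^sup>2"
      using assms by (intro power_mono) auto
    moreover have "(2 ^ j * y)\<^sup>2 = (2 * 2) ^ j * y\<^sup>2"
      unfolding power_mult_distrib by (simp add: power2_eq_square)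
    ultimately have *: "4 ^ j * y\<^sup>2 \<le> s\<^sup>2 + y\<^sup>2" by (simp add: add_increasing2)
    have "y / (s\<^sup>2 + y\<^sup>2) \<le> y / (4 ^ j * y\<^sup>2)"
      using assms * by (intro divide_left_mono) (auto intro!: mult_pos_pos add_nonneg_pos)
    also have "\<dots> = 1 / (4 ^ j * y)"
      using assms by (simp add: power2_eq_square)
    finally have "1 / pi * (y / (s\<^sup>2 + y\<^sup>2)) \<le> 1 / pi * (1 / (4 ^ j * y))"
      by (intro mult_left_mono) auto
    then show ?thesis
      using Suc by (simp add: poisson_kernel_def mult_ac)
  qed
  also have "\<dots> = 4 / (pi * y * 4 ^ k) * of_bool (\<bar>s\<bar> \<le> 2 ^ k * y)"
    using k by simp
  also have "\<dots> \<le> (\<Sum>k\<le>K. 4 / (pi * y * 4 ^ k) * of_bool (\<bar>s\<bar> \<le> 2 ^ k * y))"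
    using assms k by (intro member_le_sum) auto
  finally show ?thesis .
qed

text \<open>The dyadic bound summed against the averages gives a geometric series of total at most
  \<open>8 * A / pi\<close>. The result depends neither on \<open>y\<close> nor on the support,
  which only limits the number of dyadic scales.\<close>

lemma poisson_integral_le_maximal:
  fixes H :: "real \<Rightarrow> real"
  assumes int: "integrable lborel H" and nonneg: "\<And>t. 0 \<le> H t"
    and support: "\<And>t. R < \<bar>t\<bar> \<Longrightarrow> H t = 0" and y: "0 < y"
    and average: "\<And>r. 0 < r \<Longrightarrow> (LINT t|lborel. indicator {x - r..x + r} t * H t) \<le> A * r"
  shows "poisson_integral H x y \<le> 4 * A"
proof -
  have [measurable]: "H \<in> borel_measurable borel"
    using borel_measurable_integrable[OF int] by simp
  have "0 \<le> (LINT t|lborel. indicator {x - 1..x + 1} t * H t)"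
    using nonneg by (intro integral_nonneg_AE) auto
  then have A: "0 \<le> A" using average[of 1] by linarith
  obtain K :: nat where "(\<bar>x\<bar> + \<bar>R\<bar>) / y < 2 ^ K"
    using real_arch_pow[of 2] by auto
  then have K: "\<bar>x\<bar> + \<bar>R\<bar> \<le> 2 ^ K * y"
    using y by (simp add: field_simps)
  have ind_int: "integrable lborel (\<lambda>t. indicator {x - r..x + r} t * H t)" for r
    using integrable_real_mult_indicator[OF _ int, of "{x - r..x + r}"] by (simp add: mult.commute)
  have term_int: "integrable lborel (\<lambda>t. c * (indicator {x - r..x + r} t * H t))" for c r
    using ind_int by (rule integrable_mult_right)
  have pointwise: "poisson_kernel y (x - t) * H t \<le>
    (\<Sum>k\<le>K. 4 / (pi * y * 4 ^ k) * (indicator {x - 2 ^ k * y..x + 2 ^ k * y} t * H t))" for t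
  proof (cases "R < \<bar>t\<bar>")
    case True
    then show ?thesis using support by simp
  next
    case False
    then have "\<bar>x - t\<bar> \<le> 2 ^ K * y" using K by linarith
    then have "poisson_kernel y (x - t) * H t \<le>
      (\<Sum>k\<le>K. 4 / (pi * y * 4 ^ k) * of_bool (\<bar>x - t\<bar> \<le> 2 ^ k * y)) * H t"
      using poisson_kernel_le_dyadic_sum[OF y] nonneg by (intro mult_right_mono)
    also have "\<dots> = (\<Sum>k\<le>K. 4 / (pi * y * 4 ^ k) * (indicator {x - 2 ^ k * y..x + 2 ^ k * y} t * H t))"
      unfolding sum_distrib_right by (intro sum.cong) (auto simp: indicator_def abs_le_iff)
    finally show ?thesis .
  qed
  have kernel_int: "integrable lborel (\<lambda>t. poisson_kernel y (x - t) * H t)"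
  proof (rule Bochner_Integration.integrable_bound)
    show "integrable lborel (\<lambda>t. 1 / (pi * y) * H t)"
      using int by (rule integrable_mult_right)
    show "AE t in lborel. norm (poisson_kernel y (x - t) * H t) \<le> norm (1 / (pi * y) * H t)"
      using poisson_kernel_le[OF y] poisson_kernel_nonneg[OF y] y
      by (intro AE_I2) (simp add: abs_mult mult_right_mono del: times_divide_eq_left)
  qed simp
  have "poisson_integral H x y \<le>
    (LINT t|lborel. (\<Sum>k\<le>K. 4 / (pi * y * 4 ^ k) * (indicator {x - 2 ^ k * y..x + 2 ^ k * y} t * H t)))"
    unfolding poisson_integral_lborel[OF \<open>H \<in> borel_measurable borel\<close>]
    by (intro integral_mono kernel_int Bochner_Integration.integrable_sum term_int pointwise)
  also have "\<dots> = (\<Sum>k\<le>K. 4 / (pi * y * 4 ^ k) *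
      (LINT t|lborel. indicator {x - 2 ^ k * y..x + 2 ^ k * y} t * H t))"
    by (subst Bochner_Integration.integral_sum) (simp_all only: term_int integral_mult_right_zero)
  also have "\<dots> \<le> (\<Sum>k\<le>K. 4 / (pi * y * 4 ^ k) * (A * (2 ^ k * y)))"
    using y by (intro sum_mono mult_left_mono average) auto
  also have "\<dots> = (\<Sum>k\<le>K. 4 * A / pi * (1 / 2) ^ k)"
  proof (rule sum.cong[OF refl])
    fix k
    have "(4::real) ^ k = 2 ^ k * 2 ^ k"
      by (simp flip: power_mult_distrib)
    then show "4 / (pi * y * 4 ^ k) * (A * (2 ^ k * y)) = 4 * A / pi * (1 / 2) ^ k"
      using y by (simp add: field_simps)
  qed
  also have "\<dots> = 4 * A / pi * (2 - (1 / 2) ^ K)"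
  proof -
    have "(\<Sum>k\<le>K. (1 / 2) ^ k) = 2 - (1 / 2 :: real) ^ K"
      by (induction K) auto
    then show ?thesis by (simp only: flip: sum_distrib_left)
  qed
  also have "\<dots> \<le> 4 * A / pi * 2"
    using A by (intro mult_left_mono) auto
  also have "\<dots> \<le> 4 * A"
    using A pi_gt3 by (simp add: field_simps mult_left_mono)
  finally show ?thesis .
qed

section \<open>The Poisson kernel as an approximate identity\<close>

lemma has_bochner_integral_inverse_1_plus_square:
  "has_bochner_integral lborel (\<lambda>u::real. inverse (1 + u\<^sup>2)) pi"
  using integrable_inverse_1_plus_square LBINT_inverse_1_plus_square
  by (simp add: has_bochner_integral_iff set_integrable_def interval_lebesgue_integral_def
      set_lebesgue_integral_def einterval_def)

text \<open>The substitution \<open>t = x + y * u\<close> turns all kernels into one fixed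
  probability density, and dominated convergence applies with \<open>K\<close> times that density as
  majorant.\<close>

lemma poisson_integral_tendsto_continuous:
  fixes G :: "real \<Rightarrow> real"
  assumes cont: "continuous_on UNIV G" and bound: "\<And>t. \<bar>G t\<bar> \<le> K"
  shows "((\<lambda>y. poisson_integral G x y) \<longlongrightarrow> G x) (at_right 0)"
proof -
  have [measurable]: "G \<in> borel_measurable borel"
    using cont by (rule borel_measurable_continuous_onI)
  let ?c = "\<lambda>u::real. 1 / pi * inverse (1 + u\<^sup>2)"
  have c: "integrable lborel ?c" "(LINT u|lborel. ?c u) = 1"
    using has_bochner_integral_inverse_1_plus_square by (simp_all add: has_bochner_integral_iff)
  have rescale: "poisson_integral G x y = (LINT u|lborel. ?c u * G (x + y * u))" if "0 < y" for y
  proof -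
    have "poisson_integral G x y =
      \<bar>y\<bar> *\<^sub>R (LINT u|lborel. poisson_kernel y (x - (x + y * u)) * G (x + y * u))"
      unfolding poisson_integral_lborel[OF \<open>G \<in> borel_measurable borel\<close>]
      using that by (intro lborel_integral_real_affine) simp
    also have "\<dots> = (LINT u|lborel. y * (poisson_kernel y (x - (x + y * u)) * G (x + y * u)))"
      using that by simp
    also have "\<dots> = (LINT u|lborel. ?c u * G (x + y * u))"
    proof (rule Bochner_Integration.integral_cong[OF refl])
      fix u
      have "y * poisson_kernel y (x - (x + y * u)) = 1 / pi * (y\<^sup>2 / (y\<^sup>2 * (1 + u\<^sup>2)))"
        by (simp add: poisson_kernel_def power2_eq_square algebra_simps)
      also have "\<dots> = ?c u"
        using that by (simp add: inverse_eq_divide)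
      finally show "y * (poisson_kernel y (x - (x + y * u)) * G (x + y * u)) = ?c u * G (x + y * u)"
        by (metis mult.assoc)
    qed
    finally show ?thesis .
  qed
  show ?thesis
    unfolding tendsto_at_iff_sequentially
  proof (intro allI impI)
    fix X :: "nat \<Rightarrow> real"
    assume X: "\<forall>i. X i \<in> {0<..} - {0}" "X \<longlonglongrightarrow> 0"
    have "(\<lambda>i. LINT u|lborel. ?c u * G (x + X i * u)) \<longlonglongrightarrow> (LINT u|lborel. ?c u * G x)"
    proof (rule integral_dominated_convergence)
      show "integrable lborel (\<lambda>u. ?c u * K)"
        using c(1) by (rule integrable_mult_left)
      show "AE u in lborel. (\<lambda>i. ?c u * G (x + X i * u)) \<longlonglongrightarrow> ?c u * G x"
      proof (intro AE_I2 tendsto_mult_left)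
        fix u
        have "(\<lambda>i. x + X i * u) \<longlonglongrightarrow> x + 0 * u"
          by (intro tendsto_intros X)
        then show "(\<lambda>i. G (x + X i * u)) \<longlonglongrightarrow> G x"
          using cont by (intro isCont_tendsto_compose[of x G])
            (simp_all add: continuous_on_eq_continuous_at)
      qed
      show "AE u in lborel. norm (?c u * G (x + X i * u)) \<le> ?c u * K" for i
      proof (rule AE_I2)
        fix u :: real
        have "0 \<le> ?c u" by simp
        then show "norm (?c u * G (x + X i * u)) \<le> ?c u * K"
          using bound unfolding real_norm_def abs_mult[of "?c u"] abs_of_nonneg[OF \<open>0 \<le> ?c u\<close>]
          by (intro mult_left_mono)
      qed
    qed measurable
    also have "(LINT u|lborel. ?c u * G x) = G x"
      using c by (simp only: integral_mult_left_zero)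
    finally show "((\<lambda>y. poisson_integral G x y) \<circ> X) \<longlonglongrightarrow> G x"
      using X by (simp add: rescale o_def)
  qed
qed

section \<open>From bounds on increments to pointwise limits\<close>

lemma geometric_increments_converge:
  fixes s :: "nat \<Rightarrow> real"
  assumes "\<And>n. N \<le> n \<Longrightarrow> \<bar>s (Suc n) - s n\<bar> \<le> B / 2 ^ n"
  shows "\<exists>l. s \<longlonglongrightarrow> l \<and> (\<forall>n\<ge>N. \<bar>s n - l\<bar> \<le> 2 * B / 2 ^ n)"
proof -
  have "0 \<le> B / 2 ^ N"
    using assms[of N] by linarith
  then have B: "0 \<le> B"
    using mult_nonneg_nonneg[of "B / 2 ^ N" "2 ^ N"] by simp
  \<comment> \<open>The right-hand side is the exact partial sum of the geometric series, so that
    the induction closes.\<close>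
  have step: "\<bar>s (n + k) - s n\<bar> \<le> 2 * B / 2 ^ n - 2 * B / 2 ^ (n + k)" if "N \<le> n" for n k
  proof (induction k)
    case (Suc k)
    have "\<bar>s (Suc (n + k)) - s (n + k)\<bar> \<le> B / 2 ^ (n + k)"
      using that by (intro assms) simp
    moreover have "2 * B / 2 ^ (n + Suc k) = B / 2 ^ (n + k)" by simp
    moreover have "2 * B / 2 ^ (n + k) = B / 2 ^ (n + k) + B / 2 ^ (n + k)" by simp
    ultimately show ?case using Suc.IH by simp
  qed simp
  have bound: "\<bar>s m - s n\<bar> \<le> 2 * B / 2 ^ n" if "N \<le> n" "n \<le> m" for m n
  proof -
    have "\<bar>s m - s n\<bar> \<le> 2 * B / 2 ^ n - 2 * B / 2 ^ m"
      using step[OF that(1), of "m - n"] that(2) by simp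
    moreover have "0 \<le> 2 * B / 2 ^ m" using B by simp
    ultimately show ?thesis by linarith
  qed
  have "(\<lambda>n. 2 * B * (1 / 2) ^ n) \<longlonglongrightarrow> 2 * B * 0"
    by (intro tendsto_mult_left LIMSEQ_power_zero) simp
  then have small: "(\<lambda>n. 2 * B / 2 ^ n) \<longlonglongrightarrow> 0"
    by (simp add: power_one_over)
  have "Cauchy s"
  proof (rule metric_CauchyI)
    fix e :: real assume "0 < e"
    then have "eventually (\<lambda>n. 2 * B / 2 ^ n < e) sequentially"
      using small by (intro order_tendstoD) auto
    then obtain M where M: "\<And>n. M \<le> n \<Longrightarrow> 2 * B / 2 ^ n < e"
      unfolding eventually_sequentially by blast
    show "\<exists>M. \<forall>m\<ge>M. \<forall>n\<ge>M. dist (s m) (s n) < e"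
    proof (intro exI[of _ "max M N"] allI impI)
      fix m n assume "max M N \<le> m" "max M N \<le> n"
      then show "dist (s m) (s n) < e"
        using bound[of m n] bound[of n m] M[of m] M[of n]
        by (cases "m \<le> n") (auto simp: dist_real_def abs_minus_commute)
    qed
  qed
  then obtain l where l: "s \<longlonglongrightarrow> l"
    using Cauchy_convergent convergent_def by blast
  have "\<bar>s n - l\<bar> \<le> 2 * B / 2 ^ n" if "N \<le> n" for n
  proof -
    have "(\<lambda>m. \<bar>s m - s n\<bar>) \<longlonglongrightarrow> \<bar>l - s n\<bar>"
      by (intro tendsto_intros l)
    then have "\<bar>l - s n\<bar> \<le> 2 * B / 2 ^ n"
      using bound[OF that] by (intro LIMSEQ_le_const2) auto
    then show ?thesis by (simp add: abs_minus_commute)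
  qed
  then show ?thesis using l by blast
qed

text \<open>A three-term estimate through \<open>G n\<close>: its Poisson integral is close to that
  of \<open>f\<close> uniformly in \<open>y\<close>, close to \<open>G n x\<close> for small
  \<open>y\<close>, and \<open>G n x\<close> is close to the limit. Uniformity allows
  \<open>n\<close> to be fixed before \<open>y\<close>.\<close>

lemma poisson_integral_tendsto_of_maximal_bounds:
  fixes f :: "real \<Rightarrow> real" and G :: "nat \<Rightarrow> real \<Rightarrow> real"
  assumes f: "integrable lebesgue f"
    and cont: "\<And>n. continuous_on UNIV (G n)"
    and support: "\<And>n t. R n < \<bar>t\<bar> \<Longrightarrow> G n t = 0"
    and L1: "(\<lambda>n. LINT t|lebesgue. \<bar>G n t - f t\<bar>) \<longlonglongrightarrow> 0"
    and increment: "\<And>n. N \<le> n \<Longrightarrow> \<bar>G (Suc n) x - G n x\<bar> \<le> A / 2 ^ n"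
    and average: "\<And>n r. N \<le> n \<Longrightarrow> 0 < r \<Longrightarrow>
      (LINT t|lborel. indicator {x - r..x + r} t * \<bar>G (Suc n) t - G n t\<bar>) \<le> A / 2 ^ n * r"
  shows "\<exists>v. (\<lambda>n. G n x) \<longlonglongrightarrow> v \<and> ((\<lambda>y. poisson_integral f x y) \<longlongrightarrow> v) (at_right 0)"
proof -
  have [measurable]: "G n \<in> borel_measurable borel" for n
    using cont by (rule borel_measurable_continuous_onI)
  have bounded: "\<exists>K. \<forall>t. \<bar>G n t\<bar> \<le> K" for n
  proof -
    have "compact (G n ` {- R n..R n})"
      using cont by (intro compact_continuous_image continuous_on_subset[OF cont]) auto
    then obtain K where "\<And>z. z \<in> G n ` {- R n..R n} \<Longrightarrow> norm z \<le> K"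
      using compact_imp_bounded bounded_iff by metis
    then have "\<bar>G n t\<bar> \<le> K" if "t \<in> {- R n..R n}" for t
      using that by (metis imageI real_norm_def)
    then have "\<bar>G n t\<bar> \<le> max K 0" for t
      using support[of n t] by (cases "R n < \<bar>t\<bar>") (auto simp: le_max_iff_disj not_less abs_le_iff)
    then show ?thesis by blast
  qed
  have G_int: "integrable lborel (G n)" for n
  proof -
    have "integrable lborel (\<lambda>t. indicator {- R n..R n} t *\<^sub>R G n t)"
      by (intro borel_integrable_compact continuous_on_subset[OF cont]) auto
    moreover have "indicator {- R n..R n} t *\<^sub>R G n t = G n t" for t
      using support[of n t] by (cases "R n < \<bar>t\<bar>") (auto simp: indicator_def abs_le_iff not_less)
    ultimately show ?thesis by (simp only:)
  qed
  then have G_int': "integrable lebesgue (G n)" for n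
    by (simp add: integrable_completion)
  have poisson_increment: "\<bar>poisson_integral (G (Suc n)) x y - poisson_integral (G n) x y\<bar> \<le> 4 * A / 2 ^ n"
    if "N \<le> n" "0 < y" for n y
  proof -
    have "\<bar>poisson_integral (G (Suc n)) x y - poisson_integral (G n) x y\<bar> =
        \<bar>poisson_integral (\<lambda>t. G (Suc n) t - G n t) x y\<bar>"
      using that by (simp add: poisson_integral_diff G_int')
    also have "\<dots> \<le> poisson_integral (\<lambda>t. \<bar>G (Suc n) t - G n t\<bar>) x y"
      using that by (intro abs_poisson_integral_le)
    also have "\<dots> \<le> 4 * (A / 2 ^ n)"
    proof (rule poisson_integral_le_maximal)
      show "integrable lborel (\<lambda>t. \<bar>G (Suc n) t - G n t\<bar>)"
        by (intro integrable_abs Bochner_Integration.integrable_diff G_int)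
      show "\<bar>G (Suc n) t - G n t\<bar> = 0" if "max (R (Suc n)) (R n) < \<bar>t\<bar>" for t
        using that support by simp
    qed (use that average in auto)
    finally show ?thesis by simp
  qed
  have poisson_approx: "\<bar>poisson_integral (G n) x y - poisson_integral f x y\<bar> \<le> 8 * A / 2 ^ n"
    if "N \<le> n" "0 < y" for n y
  proof -
    have "\<exists>l. (\<lambda>n. poisson_integral (G n) x y) \<longlonglongrightarrow> l \<and>
        (\<forall>n\<ge>N. \<bar>poisson_integral (G n) x y - l\<bar> \<le> 2 * (4 * A) / 2 ^ n)"
      using that poisson_increment by (intro geometric_increments_converge)
    then obtain l where l: "(\<lambda>n. poisson_integral (G n) x y) \<longlonglongrightarrow> l"
      "\<And>n. n \<ge> N \<Longrightarrow> \<bar>poisson_integral (G n) x y - l\<bar> \<le> 2 * (4 * A) / 2 ^ n"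
      by blast
    \<comment> \<open>The \<open>L^1\<close> convergence only identifies the limit for each fixed
      \<open>y\<close>. Its rate degenerates as \<open>y\<close> tends to 0, but a uniform rate is
      already supplied by the increments.\<close>
    have "(\<lambda>n. poisson_integral (G n) x y - poisson_integral f x y) \<longlonglongrightarrow> 0"
    proof (rule Lim_null_comparison)
      show "\<forall>\<^sub>F n in sequentially. norm (poisson_integral (G n) x y - poisson_integral f x y)
          \<le> 1 / (pi * y) * (LINT t|lebesgue. \<bar>G n t - f t\<bar>)"
      proof (intro always_eventually allI)
        fix n
        show "norm (poisson_integral (G n) x y - poisson_integral f x y)
          \<le> 1 / (pi * y) * (LINT t|lebesgue. \<bar>G n t - f t\<bar>)"
          using poisson_integral_le_L1[of "\<lambda>t. G n t - f t" y x] G_int' f that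
          by (simp add: poisson_integral_diff)
      qed
      show "(\<lambda>n. 1 / (pi * y) * (LINT t|lebesgue. \<bar>G n t - f t\<bar>)) \<longlonglongrightarrow> 0"
        using tendsto_mult_left[OF L1, of "1 / (pi * y)"] by simp
    qed
    then have "(\<lambda>n. poisson_integral (G n) x y) \<longlonglongrightarrow> poisson_integral f x y"
      by (rule LIM_zero_cancel)
    then have "l = poisson_integral f x y"
      using l(1) LIMSEQ_unique by blast
    then show ?thesis using l(2)[OF that(1)] by simp
  qed
  obtain v where v: "(\<lambda>n. G n x) \<longlonglongrightarrow> v" "\<And>n. n \<ge> N \<Longrightarrow> \<bar>G n x - v\<bar> \<le> 2 * A / 2 ^ n"
    using geometric_increments_converge[of N "\<lambda>n. G n x" A] increment by blast
  have "((\<lambda>y. poisson_integral f x y) \<longlongrightarrow> v) (at_right 0)"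
  proof (rule tendstoI)
    fix e :: real assume e: "0 < e"
    \<comment> \<open>The constant collects \<open>8 * A\<close> from the Poisson integrals and
      \<open>2 * A\<close> from the values at \<open>x\<close>.\<close>
    have "(\<lambda>n. 10 * A * (1 / 2) ^ n) \<longlonglongrightarrow> 10 * A * 0"
      by (intro tendsto_mult_left LIMSEQ_power_zero) simp
    then have "\<forall>\<^sub>F n in sequentially. 10 * A / 2 ^ n < e / 2"
      using e by (intro order_tendstoD) (auto simp: power_one_over)
    then have "\<forall>\<^sub>F n in sequentially. 10 * A / 2 ^ n < e / 2 \<and> N \<le> n"
      using eventually_ge_at_top by (rule eventually_conj)
    then obtain n where n: "10 * A / 2 ^ n < e / 2" "N \<le> n"
      using eventually_happens trivial_limit_sequentially by blast
    obtain K where "\<And>t. \<bar>G n t\<bar> \<le> K" using bounded by blast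
    then have "\<forall>\<^sub>F y in at_right 0. dist (poisson_integral (G n) x y) (G n x) < e / 2"
      using e by (intro tendstoD poisson_integral_tendsto_continuous cont) auto
    moreover have "\<forall>\<^sub>F y :: real in at_right 0. 0 < y"
      by (rule eventually_at_right_less)
    ultimately show "\<forall>\<^sub>F y in at_right 0. dist (poisson_integral f x y) v < e"
    proof eventually_elim
      case (elim y)
      have "10 * A / 2 ^ n = 8 * A / 2 ^ n + 2 * A / 2 ^ n" by simp
      then show ?case
        using elim poisson_approx[OF n(2) elim(2)] v(2)[OF n(2)] n(1)
        unfolding dist_real_def by linarith
    qed
  qed
  then show ?thesis using v(1) by blast
qed

subsection \<open>A discrete maximal inequality\<close>

text \<open>Scan from left to right. A bad \<open>j\<close> with witness \<open>b\<close> has the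
  whole block from \<open>j\<close> up to \<open>b\<close> charged to the growth of \<open>S\<close>
  there, at a price below that growth; a good \<open>j\<close> is skipped by monotonicity. The
  blocks are disjoint, so no covering constant is lost.\<close>

lemma discrete_rising_sun_right:
  fixes S :: "nat \<Rightarrow> real"
  assumes mono: "\<And>i. S i \<le> S (Suc i)" and e: "0 \<le> e"
  shows "e * real (card {j. j < N \<and> (\<exists>b\<le>N. j < b \<and> e * (real b - real j) < S b - S j)}) \<le> S N - S 0"
proof -
  define B where "B = {j. j < N \<and> (\<exists>b\<le>N. j < b \<and> e * (real b - real j) < S b - S j)}"
  have [simp]: "finite B"
    by (rule finite_subset[of _ "{..<N}"]) (auto simp: B_def)
  have "e * real (card (B \<inter> {j..})) \<le> S N - S j" if "j \<le> N" for j
    using that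
  proof (induction "N - j" arbitrary: j rule: less_induct)
    case less
    consider "j = N" | "j < N" "j \<notin> B" | "j \<in> B"
      using less.prems by linarith
    then show ?case
    proof cases
      case 1
      then have "B \<inter> {j..} = {}" by (auto simp: B_def)
      then show ?thesis using 1 by simp
    next
      case 2
      then have "B \<inter> {j..} = B \<inter> {Suc j..}"
        by (auto simp: Suc_le_eq order_less_le)
      moreover have "e * real (card (B \<inter> {Suc j..})) \<le> S N - S (Suc j)"
        using 2 by (intro less.hyps) auto
      ultimately show ?thesis using mono[of j] by simp
    next
      case 3
      then obtain b where b: "j < b" "b \<le> N" "e * (real b - real j) < S b - S j"
        by (auto simp: B_def)
      have "card (B \<inter> {j..}) \<le> card ({j..<b} \<union> (B \<inter> {b..}))"
        by (intro card_mono) auto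
      also have "\<dots> \<le> (b - j) + card (B \<inter> {b..})"
        using card_Un_le[of "{j..<b}" "B \<inter> {b..}"] by simp
      finally have "real (card (B \<inter> {j..})) \<le> (real b - real j) + real (card (B \<inter> {b..}))"
        using b by linarith
      then have "e * real (card (B \<inter> {j..})) \<le> e * (real b - real j) + e * real (card (B \<inter> {b..}))"
        using e by (simp add: mult_left_mono flip: distrib_left)
      moreover have "e * real (card (B \<inter> {b..})) \<le> S N - S b"
        using b by (intro less.hyps) auto
      ultimately show ?thesis using b by linarith
    qed
  qed
  from this[of 0] show ?thesis by (simp add: B_def)
qed

text \<open>The mirror image, scanning from the right end: a bad last cell with witness
  \<open>a\<close> removes the block from \<open>a\<close> on. The cell \<open>j\<close> belongs to
  its own averages, hence \<open>Suc j\<close>.\<close>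

lemma discrete_rising_sun_left:
  fixes S :: "nat \<Rightarrow> real"
  assumes mono: "\<And>i. S i \<le> S (Suc i)" and e: "0 \<le> e"
  shows "e * real (card {j. j < N \<and> (\<exists>a\<le>j. e * (real (Suc j) - real a) < S (Suc j) - S a)}) \<le> S N - S 0"
proof (induction N rule: less_induct)
  case (less N)
  define B where "B N = {j. j < N \<and> (\<exists>a\<le>j. e * (real (Suc j) - real a) < S (Suc j) - S a)}" for N
  have [simp]: "finite (B N)" for N
    by (rule finite_subset[of _ "{..<N}"]) (auto simp: B_def)
  have IH: "e * real (card (B k)) \<le> S k - S 0" if "k < N" for k
    using less[OF that] by (simp add: B_def)
  have "e * real (card (B N)) \<le> S N - S 0"
  proof (cases N)
    case 0
    then show ?thesis by (simp add: B_def)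
  next
    case (Suc i)
    show ?thesis
    proof (cases "i \<in> B N")
      case True
      then obtain a where a: "a \<le> i" "e * (real N - real a) < S N - S a"
        by (auto simp: B_def Suc)
      have "card (B N) \<le> card ({a..<N} \<union> B a)"
        by (intro card_mono) (auto simp: B_def not_le)
      also have "\<dots> \<le> (N - a) + card (B a)"
        using card_Un_le[of "{a..<N}" "B a"] by simp
      finally have "real (card (B N)) \<le> (real N - real a) + real (card (B a))"
        using a Suc by linarith
      then have "e * real (card (B N)) \<le> e * (real N - real a) + e * real (card (B a))"
        using e by (simp add: mult_left_mono flip: distrib_left)
      then show ?thesis using a IH[of a] Suc by simp
    next
      case False
      then have "B N = B i"
        by (auto simp: B_def Suc less_Suc_eq)
      then show ?thesis using IH[of i] mono[of i] Suc by simp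
    qed
  qed
  then show ?case by (simp add: B_def)
qed

section \<open>Sampling on a dyadic grid\<close>

definition grid_point :: "nat \<Rightarrow> nat \<Rightarrow> nat \<Rightarrow> real" where
  "grid_point E P j = real j / 2 ^ P - real E"

definition grid_sum :: "(real \<Rightarrow> real) \<Rightarrow> nat \<Rightarrow> nat \<Rightarrow> nat \<Rightarrow> real" where
  "grid_sum H E P k = (\<Sum>i<k. H (grid_point E P i))"

text \<open>A discrete one-sided maximal function above the level \<open>e\<close>, to the right or
  to the left, with the cell \<open>j\<close> in both kinds of blocks. The outer \<open>Suc\<close>
  in the bounds admits the right end of the grid and the single cell \<open>a = j\<close>. The
  quantifiers are bounded, so the predicate is decidable for rational samples.\<close>

definition dense_cell :: "(real \<Rightarrow> real) \<Rightarrow> nat \<Rightarrow> nat \<Rightarrow> real \<Rightarrow> nat \<Rightarrow> bool" where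
  "dense_cell H E P e j \<longleftrightarrow>
    (\<exists>b<Suc (2 * E * 2 ^ P). j < b \<and> e * (real b - real j) < grid_sum H E P b - grid_sum H E P j) \<or>
    (\<exists>a<Suc j. e * (real (Suc j) - real a) < grid_sum H E P (Suc j) - grid_sum H E P a)"

locale sampled_function =
  fixes H :: "real \<Rightarrow> real" and L :: real and E P :: nat
  assumes nonneg: "0 \<le> H t"
    and lipschitz: "\<bar>H s - H t\<bar> \<le> L * \<bar>s - t\<bar>"
    and support: "real E \<le> \<bar>t\<bar> \<Longrightarrow> H t = 0"
    and L_nonneg: "0 \<le> L"
begin

abbreviation "point \<equiv> grid_point E P"
abbreviation "ncells \<equiv> 2 * E * 2 ^ P"
abbreviation "cell i \<equiv> {point i..<point (Suc i)}"
abbreviation "index t \<equiv> nat \<lfloor>(t + real E) * 2 ^ P\<rfloor>"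

lemma point_Suc: "point (Suc i) = point i + 1 / 2 ^ P"
  by (simp add: grid_point_def field_simps)

text \<open>The half-open cells are the level sets of a floor. The lower bound on \<open>t\<close>
  is essential, since \<open>nat\<close> sends every point left of the grid to the index 0.\<close>

lemma in_cell_iff: "t \<in> cell i \<longleftrightarrow> - real E \<le> t \<and> i = index t"
proof -
  have 1: "t \<in> cell i \<longleftrightarrow> real i \<le> (t + real E) * 2 ^ P \<and> (t + real E) * 2 ^ P < real i + 1"
    by (simp add: grid_point_def field_simps)
  have 2: "- real E \<le> t \<longleftrightarrow> 0 \<le> (t + real E) * 2 ^ P"
    using mult_le_cancel_right_pos[of "2 ^ P" 0 "t + real E"] by auto
  show ?thesis unfolding 1 2 by linarith
qed

lemma index_less_ncells:
  assumes "t < real E" "0 < E"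
  shows "index t < ncells"
proof -
  have "(t + real E) * 2 ^ P < (real E + real E) * 2 ^ P"
    using assms by (intro mult_strict_right_mono) auto
  also have "\<dots> = real ncells" by simp
  finally have "(t + real E) * 2 ^ P < real ncells" .
  moreover have "0 < real ncells" using assms by simp
  ultimately show ?thesis by linarith
qed

lemma in_cell_less:
  assumes "t \<in> cell i" "i < ncells"
  shows "t < real E"
proof -
  have "t < real (Suc i) / 2 ^ P - real E"
    using assms by (simp add: grid_point_def)
  also have "real (Suc i) \<le> real ncells"
    using assms by linarith
  then have "real (Suc i) / 2 ^ P - real E \<le> real ncells / 2 ^ P - real E"
    by (intro diff_right_mono divide_right_mono) auto
  finally show ?thesis by simp
qed

lemma cell_oscillation:
  assumes "t \<in> cell i"
  shows "\<bar>H t - H (point i)\<bar> \<le> L / 2 ^ P"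
proof -
  have "\<bar>H t - H (point i)\<bar> \<le> L * \<bar>t - point i\<bar>" by (rule lipschitz)
  also have "\<dots> \<le> L * (1 / 2 ^ P)"
    using assms L_nonneg unfolding atLeastLessThan_iff point_Suc by (intro mult_left_mono) auto
  finally show ?thesis by simp
qed

lemma continuous: "continuous_on UNIV H"
proof -
  have "L-lipschitz_on UNIV H"
    using lipschitz L_nonneg by (intro lipschitz_onI) (auto simp: dist_real_def)
  then show ?thesis by (rule lipschitz_on_continuous_on)
qed

lemma borel [measurable]: "H \<in> borel_measurable borel"
  using continuous by (rule borel_measurable_continuous_onI)

lemma integrable: "integrable lborel H"
proof -
  have "integrable lborel (\<lambda>t. indicator {- real E..real E} t *\<^sub>R H t)"
    by (intro borel_integrable_compact continuous_on_subset[OF continuous]) auto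
  moreover have "indicator {- real E..real E} t *\<^sub>R H t = H t" for t
    using support[of t] by (cases "real E \<le> \<bar>t\<bar>") (auto simp: indicator_def not_le abs_less_iff)
  ultimately show ?thesis by (simp only:)
qed

lemma integrable_cell_sum:
  fixes w :: "nat \<Rightarrow> real"
  shows "integrable lborel (\<lambda>t. \<Sum>i\<in>I. w i * indicator (cell i) t)"
  by (intro Bochner_Integration.integrable_sum integrable_mult_right)
    (simp add: point_Suc)

lemma integral_cell_sum:
  fixes w :: "nat \<Rightarrow> real"
  shows "(LINT t|lborel. (\<Sum>i\<in>I. w i * indicator (cell i) t)) = (\<Sum>i\<in>I. w i) / 2 ^ P"
proof -
  have "(LINT t|lborel. (\<Sum>i\<in>I. w i * indicator (cell i) t)) =
      (\<Sum>i\<in>I. LINT t|lborel. w i * indicator (cell i) t)"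
    by (intro Bochner_Integration.integral_sum integrable_mult_right) (simp add: point_Suc)
  also have "\<dots> = (\<Sum>i\<in>I. w i * (1 / 2 ^ P))"
    by (simp add: point_Suc)
  finally show ?thesis by (simp add: sum_divide_distrib)
qed

lemma cell_sum_eq:
  fixes w :: "nat \<Rightarrow> real"
  assumes "finite I" "- real E \<le> t" "index t \<in> I"
  shows "(\<Sum>i\<in>I. w i * indicator (cell i) t) = w (index t)"
proof -
  have "(\<Sum>i\<in>I. w i * indicator (cell i) t) = (\<Sum>i\<in>I. if i = index t then w i else 0)"
    using assms by (intro sum.cong) (auto simp: indicator_def in_cell_iff simp del: atLeastLessThan_iff)
  then show ?thesis using assms by simp
qed

text \<open>On each cell the sample exceeds \<open>H\<close> by at most the oscillation
  \<open>L / 2 ^ P\<close>, and the grid has total length \<open>2 * E\<close>.\<close>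

lemma grid_sum_le_integral:
  "grid_sum H E P ncells / 2 ^ P \<le> (LINT t|lborel. H t) + L / 2 ^ P * (2 * real E)"
proof -
  have "grid_sum H E P ncells / 2 ^ P = (LINT t|lborel. (\<Sum>i<ncells. H (point i) * indicator (cell i) t))"
    unfolding grid_sum_def by (simp only: integral_cell_sum)
  also have "\<dots> \<le> (LINT t|lborel. H t + L / 2 ^ P * indicator {- real E..<real E} t)"
  proof (rule integral_mono)
    show "integrable lborel (\<lambda>t. H t + L / 2 ^ P * indicator {- real E..<real E} t)"
      by (intro Bochner_Integration.integrable_add integrable integrable_mult_right) simp
    fix t
    show "(\<Sum>i<ncells. H (point i) * indicator (cell i) t) \<le> H t + L / 2 ^ P * indicator {- real E..<real E} t"
    proof (cases "t \<in> {- real E..<real E}")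
      case True
      then have "index t < ncells" by (intro index_less_ncells) auto
      then have "(\<Sum>i<ncells. H (point i) * indicator (cell i) t) = H (point (index t))"
        using True cell_sum_eq[of "{..<ncells}" t "\<lambda>i. H (point i)"] by simp
      moreover have "\<bar>H t - H (point (index t))\<bar> \<le> L / 2 ^ P"
        using True by (intro cell_oscillation in_cell_iff[THEN iffD2] conjI refl) auto
      ultimately show ?thesis using True by simp
    next
      case False
      then have "t \<notin> cell i" if "i < ncells" for i
        using that in_cell_less in_cell_iff by (metis atLeastLessThan_iff)
      then have "(\<Sum>i<ncells. H (point i) * indicator (cell i) t) = 0"
        by (intro sum.neutral) (auto simp del: atLeastLessThan_iff)
      then show ?thesis using nonneg[of t] False by simp
    qed
  qed (rule integrable_cell_sum)
  also have "\<dots> = (LINT t|lborel. H t) + L / 2 ^ P * (2 * real E)"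
    by (subst Bochner_Integration.integral_add) (auto intro!: integrable integrable_mult_right)
  finally show ?thesis .
qed

lemma grid_sum_mono: "grid_sum H E P i \<le> grid_sum H E P (Suc i)"
  using nonneg by (simp add: grid_sum_def)

lemma card_dense_cells:
  assumes "0 \<le> e"
  shows "e * real (card {j. j < ncells \<and> dense_cell H E P e j}) \<le> 2 * grid_sum H E P ncells"
proof -
  define B where "B = {j. j < ncells \<and> (\<exists>b\<le>ncells. j < b \<and> e * (real b - real j) < grid_sum H E P b - grid_sum H E P j)}"
  define B' where "B' = {j. j < ncells \<and> (\<exists>a\<le>j. e * (real (Suc j) - real a) < grid_sum H E P (Suc j) - grid_sum H E P a)}"
  have fin: "finite B" "finite B'"
    by (rule finite_subset[of _ "{..<ncells}"]; auto simp: B_def B'_def)+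
  have "{j. j < ncells \<and> dense_cell H E P e j} = B \<union> B'"
    unfolding dense_cell_def B_def B'_def less_Suc_eq_le by blast
  then have "real (card {j. j < ncells \<and> dense_cell H E P e j}) \<le> real (card B) + real (card B')"
    using card_Un_le[of B B'] by simp
  then have "e * real (card {j. j < ncells \<and> dense_cell H E P e j}) \<le> e * real (card B) + e * real (card B')"
    using assms by (simp add: mult_left_mono flip: distrib_left)
  also have "\<dots> \<le> (grid_sum H E P ncells - grid_sum H E P 0) + (grid_sum H E P ncells - grid_sum H E P 0)"
    unfolding B_def B'_def
    by (intro add_mono discrete_rising_sun_right discrete_rising_sun_left grid_sum_mono assms)
  also have "\<dots> = 2 * grid_sum H E P ncells" by (simp add: grid_sum_def)
  finally show ?thesis .
qed

text \<open>Each dense cell is extended by one cell to the left, so that an open interval contains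
  its left endpoint too; this doubles the length. With the factor 2 from the two one-sided
  inequalities it makes the 4. Other cells receive the empty interval.\<close>

lemma measure_dense_cells:
  assumes "0 < e"
    and a: "\<And>j. a j = (if dense_cell H E P e j then point j - 1 / 2 ^ P else 0)"
    and b: "\<And>j. b j = (if dense_cell H E P e j then point (Suc j) else 0)"
  shows "e * measure lborel (\<Union>j<ncells. {a j<..<b j}) \<le>
    4 * ((LINT t|lborel. H t) + L / 2 ^ P * (2 * real E))"
proof -
  have "measure lborel (\<Union>j<ncells. {a j<..<b j}) \<le> (\<Sum>j<ncells. measure lborel {a j<..<b j})"
    by (intro measure_UNION_le) auto
  also have "\<dots> = (\<Sum>j<ncells. if dense_cell H E P e j then 2 / 2 ^ P else 0)"
    by (intro sum.cong) (auto simp: a b point_Suc)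
  also have "\<dots> = real (card {j. j < ncells \<and> dense_cell H E P e j}) * (2 / 2 ^ P)"
    by (simp add: sum.If_cases Int_def)
  finally have "e * measure lborel (\<Union>j<ncells. {a j<..<b j}) \<le>
      e * real (card {j. j < ncells \<and> dense_cell H E P e j}) * (2 / 2 ^ P)"
    unfolding mult.assoc[of e] using assms(1) by (intro mult_left_mono) auto
  also have "\<dots> \<le> 2 * grid_sum H E P ncells * (2 / 2 ^ P)"
    using card_dense_cells[of e] assms(1) by (intro mult_right_mono) auto
  also have "\<dots> = 4 * (grid_sum H E P ncells / 2 ^ P)" by simp
  also have "\<dots> \<le> 4 * ((LINT t|lborel. H t) + L / 2 ^ P * (2 * real E))"
    by (intro mult_left_mono grid_sum_le_integral) simp
  finally show ?thesis .
qed

text \<open>For radii below the mesh the Lipschitz bound suffices. Otherwise the interval is covered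
  by cells and split at the cell of \<open>x\<close>, where sparseness bounds the sample sums on
  both sides. The constant 10 is a round bound for all cases.\<close>

lemma bounds_at_sparse_cell:
  assumes e: "L / 2 ^ P \<le> e" and x: "\<bar>x\<bar> < real E" and sparse: "\<not> dense_cell H E P e (index x)"
  shows "H x \<le> 10 * e"
    and "0 < r \<Longrightarrow> (LINT t|lborel. indicator {x - r..x + r} t * H t) \<le> 10 * e * r"
proof -
  define j where "j = index x"
  define \<delta> :: real where "\<delta> = 1 / 2 ^ P"
  have \<delta>: "0 < \<delta>" by (simp add: \<delta>_def)
  have "0 \<le> L / 2 ^ P" using L_nonneg by simp
  then have e0: "0 \<le> e" using e by linarith
  have j: "j < ncells" unfolding j_def using x by (intro index_less_ncells) auto
  have right: "(\<Sum>i\<in>{j..<b}. H (point i)) \<le> e * (real b - real j)" if "j < b" "b \<le> ncells" for b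
  proof -
    have "grid_sum H E P b - grid_sum H E P j \<le> e * (real b - real j)"
      using sparse that unfolding dense_cell_def j_def[symmetric] less_Suc_eq_le by (metis not_le)
    then show ?thesis
      using that unfolding grid_sum_def by (simp add: sum_diff_nat_ivl[of 0 j b] atLeast0LessThan flip: atLeast0LessThan)
  qed
  have left: "(\<Sum>i\<in>{a..<Suc j}. H (point i)) \<le> e * (real (Suc j) - real a)" if "a \<le> j" for a
  proof -
    have "grid_sum H E P (Suc j) - grid_sum H E P a \<le> e * (real (Suc j) - real a)"
      using sparse that unfolding dense_cell_def j_def[symmetric] less_Suc_eq_le by (metis not_le)
    then show ?thesis
      using that sum_diff_nat_ivl[of 0 a "Suc j" "\<lambda>i. H (point i)"] unfolding grid_sum_def lessThan_atLeast0 by linarith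
  qed
  have xj: "x \<in> cell j"
    using x unfolding in_cell_iff j_def by auto
  have "H (point j) \<le> e"
    using right[of "Suc j"] j by simp
  then have Hx: "H x \<le> 2 * e"
    using cell_oscillation[OF xj] e by linarith
  then show "H x \<le> 10 * e" using e0 by linarith
  have ind_int: "integrable lborel (\<lambda>t. indicator {x - r..x + r} t * H t)" for r
    using integrable_real_mult_indicator[OF _ integrable, of "{x - r..x + r}"] by (simp add: mult.commute)
  show "(LINT t|lborel. indicator {x - r..x + r} t * H t) \<le> 10 * e * r" if r: "0 < r"
  proof (cases "r < \<delta>")
    case True
    have "H t \<le> 3 * e" if "t \<in> {x - r..x + r}" for t
    proof -
      have "\<bar>H t - H x\<bar> \<le> L * \<bar>t - x\<bar>" by (rule lipschitz)
      also have "\<dots> \<le> L * \<delta>"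
        using that True L_nonneg by (intro mult_left_mono) auto
      also have "\<dots> \<le> e" using e by (simp add: \<delta>_def)
      finally show ?thesis using Hx by linarith
    qed
    then have "(LINT t|lborel. indicator {x - r..x + r} t * H t) \<le>
        (LINT t|lborel. 3 * e * indicator {x - r..x + r} t)"
      using emeasure_lborel_Icc_eq[of "x - r" "x + r"]
      by (intro integral_mono ind_int integrable_mult_right integrable_real_indicator)
        (auto simp: indicator_def)
    also have "\<dots> = 3 * e * (2 * r)" using r by simp
    also have "\<dots> \<le> 10 * e * r" using e0 r by simp
    finally show ?thesis .
  next
    case False
    define a where "a = index (x - r)"
    \<comment> \<open>The block is cut at the end of the grid, beyond which sparseness gives no
      bound; nothing is lost because \<open>H\<close> vanishes there. At the left end
      \<open>nat\<close> does the cutting.\<close>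
    define b where "b = min ncells (Suc (index (x + r)))"
    have a: "a \<le> j"
      unfolding a_def j_def using r by (intro nat_mono floor_mono mult_right_mono) auto
    have "j \<le> index (x + r)"
      unfolding j_def using r by (intro nat_mono floor_mono mult_right_mono) auto
    then have b: "j < b" "b \<le> ncells"
      using j by (auto simp: b_def)
    have pointwise: "indicator {x - r..x + r} t * H t \<le> (\<Sum>i\<in>{a..<b}. (H (point i) + e) * indicator (cell i) t)" for t
    proof (cases "t \<in> {x - r..x + r} \<and> \<bar>t\<bar> < real E")
      case True
      have "index t < ncells" using True by (intro index_less_ncells) auto
      moreover have "a \<le> index t" "index t \<le> index (x + r)"
        unfolding a_def using True by (auto intro!: nat_mono floor_mono mult_right_mono)
      ultimately have "index t \<in> {a..<b}" by (auto simp: b_def)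
      then have "(\<Sum>i\<in>{a..<b}. (H (point i) + e) * indicator (cell i) t) = H (point (index t)) + e"
        using True by (intro cell_sum_eq) (auto simp: abs_less_iff)
      moreover have "\<bar>H t - H (point (index t))\<bar> \<le> L / 2 ^ P"
        using True by (intro cell_oscillation in_cell_iff[THEN iffD2] conjI refl) auto
      ultimately show ?thesis using True e by simp
    next
      case False
      then have "indicator {x - r..x + r} t * H t = 0"
        using support[of t] by (auto simp: indicator_def)
      moreover have "0 \<le> (\<Sum>i\<in>{a..<b}. (H (point i) + e) * indicator (cell i) t)"
        using nonneg e0 by (intro sum_nonneg mult_nonneg_nonneg add_nonneg_nonneg) auto
      ultimately show ?thesis by linarith
    qed
    have "(LINT t|lborel. indicator {x - r..x + r} t * H t) \<le>
        (LINT t|lborel. (\<Sum>i\<in>{a..<b}. (H (point i) + e) * indicator (cell i) t))"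
      by (intro integral_mono ind_int integrable_cell_sum pointwise)
    also have "\<dots> = (\<Sum>i\<in>{a..<b}. H (point i) + e) * \<delta>"
      unfolding integral_cell_sum by (simp add: \<delta>_def)
    also have "(\<Sum>i\<in>{a..<b}. H (point i) + e) = (\<Sum>i\<in>{a..<b}. H (point i)) + (real b - real a) * e"
      using a b by (simp add: sum.distrib of_nat_diff)
    also have "(\<Sum>i\<in>{a..<b}. H (point i)) = (\<Sum>i\<in>{a..<j}. H (point i)) + (\<Sum>i\<in>{j..<b}. H (point i))"
      using a b by (intro sum.atLeastLessThan_concat[symmetric]) auto
    \<comment> \<open>Cell \<open>j\<close> is added because the left bound concerns blocks that
      include it; it is counted twice from here on.\<close>
    also have "(\<Sum>i\<in>{a..<j}. H (point i)) \<le> (\<Sum>i\<in>{a..<Suc j}. H (point i))"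
      using nonneg by (intro sum_mono2) auto
    also have "\<dots> \<le> e * (real (Suc j) - real a)"
      using a by (rule left)
    also have "(\<Sum>i\<in>{j..<b}. H (point i)) \<le> e * (real b - real j)"
      using b by (rule right)
    finally have "(LINT t|lborel. indicator {x - r..x + r} t * H t) \<le>
        (e * (real (Suc j) - real a) + e * (real b - real j) + (real b - real a) * e) * \<delta>"
      using \<delta> by (simp add: mult_right_mono)
    also have "\<dots> = e * (2 * ((real b - real a) * \<delta>) + \<delta>)"
      by (simp add: algebra_simps)
    also have "\<dots> \<le> e * (10 * r)"
    proof (rule mult_left_mono[OF _ e0])
      have "(x + r + real E) * 2 ^ P \<ge> 0" using x r by simp
      then have "real (index (x + r)) \<le> (x + r + real E) * 2 ^ P" by linarith
      moreover have "(x - r + real E) * 2 ^ P \<le> real a + 1"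
        unfolding a_def by linarith
      moreover have "real b \<le> real (index (x + r)) + 1" by (simp add: b_def)
      ultimately have "real b - real a \<le> (x + r + real E) * 2 ^ P - (x - r + real E) * 2 ^ P + 2"
        by linarith
      then have "real b - real a \<le> 2 * r * 2 ^ P + 2"
        by (simp add: algebra_simps)
      then have "(real b - real a) * \<delta> \<le> (2 * r * 2 ^ P + 2) * \<delta>"
        using \<delta> by (intro mult_right_mono) auto
      also have "\<dots> = 2 * r + 2 * \<delta>" by (simp add: \<delta>_def field_simps)
      \<comment> \<open>The left side is at most \<open>4 * r + 5 * \<delta>\<close>, and the mesh
        \<open>\<delta>\<close> is at most \<open>r\<close> in this case.\<close>
      finally show "2 * ((real b - real a) * \<delta>) + \<delta> \<le> 10 * r"
        using False r by linarith
    qed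
    finally show ?thesis by (simp add: mult_ac)
  qed
qed

end

subsection \<open>Convergence at Schnorr random points\<close>

lemma schnorr_random_poisson_limit:
  fixes f :: "real \<Rightarrow> real" and c :: "nat \<Rightarrow> nat"
  defines "G \<equiv> \<lambda>n. piecewise_linear (vertices_of_code (c n))"
  assumes x: "schnorr_random x" and f: "integrable lebesgue f" and c: "computable c"
    and vl: "\<And>n. vertex_list (vertices_of_code (c n))"
    and L1: "\<And>n. (LINT t|lebesgue. \<bar>G n t - f t\<bar>) \<le> 1 / 4 ^ n"
  shows "\<exists>v. (\<lambda>n. G n x) \<longlonglongrightarrow> v \<and> ((\<lambda>y. poisson_integral f x y) \<longlongrightarrow> v) (at_right 0)"
proof -
  define H where "H n t = \<bar>G (Suc n) t - G n t\<bar>" for n t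
  \<comment> \<open>The codes bound the supports. The summand \<open>Suc n\<close> makes this strict
    and lets the grids eventually cover \<open>x\<close>.\<close>
  define E where "E n = c n + c (Suc n) + Suc n" for n
  \<comment> \<open>The sum of both slope bounds, kept as a natural number so that it may enter an
    exponent.\<close>
  define L where "L n = 2 * c n * (c n + 1)\<^sup>2 + 2 * c (Suc n) * (c (Suc n) + 1)\<^sup>2" for n
  \<comment> \<open>Fine enough for the mesh times the Lipschitz constant, summed over the grid, to be negligible,
    because \<open>k \<le> 2 ^ k\<close>.\<close>
  define P where "P n = 2 * n + L n * (2 * E n)" for n
  define e :: "nat \<Rightarrow> real" where "e n = 1 / 2 ^ n" for n
  have c': "computable i \<Longrightarrow> computable (\<lambda>n. c (i n))" for i
    by (rule computable.comp[OF c])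
  have E: "computable i \<Longrightarrow> computable (\<lambda>n. E (i n))" for i
    unfolding E_def by (intro computable_intros c')
  have P: "computable i \<Longrightarrow> computable (\<lambda>n. P (i n))" for i
    unfolding P_def L_def power2_eq_square by (intro computable_intros c' E)

  have L_eq: "real (L n) = vertex_slope_bound (c (Suc n)) + vertex_slope_bound (c n)" for n
    by (simp add: L_def vertex_slope_bound_def add.commute)
  have mesh: "real (L n) / 2 ^ P n * (2 * real (E n)) \<le> 1 / 4 ^ n" for n
  proof -
    have "real (L n * (2 * E n)) \<le> 2 ^ (L n * (2 * E n))"
      by (rule less_imp_le) (rule of_nat_less_two_power)
    moreover have "(2::real) ^ P n = 4 ^ n * 2 ^ (L n * (2 * E n))"
      by (simp add: P_def power_add power_mult)
    ultimately show ?thesis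
      by (simp add: field_simps)
  qed
  have E_pos: "1 \<le> 2 * real (E n)" for n
    by (simp add: E_def)
  have e_le: "real (L n) / 2 ^ P n \<le> e n" for n
  proof -
    have "real (L n) / 2 ^ P n * 1 \<le> real (L n) / 2 ^ P n * (2 * real (E n))"
      using E_pos by (intro mult_left_mono) auto
    also have "\<dots> \<le> 1 / 4 ^ n" by (rule mesh)
    also have "\<dots> \<le> e n"
      unfolding e_def by (intro divide_left_mono power_mono) auto
    finally show ?thesis by simp
  qed
  have sampled: "sampled_function (H n) (real (L n)) (E n)" for n
  proof
    show "0 \<le> H n t" for t by (simp add: H_def)
    show "\<bar>H n s - H n t\<bar> \<le> real (L n) * \<bar>s - t\<bar>" for s t
    proof -
      have "\<bar>H n s - H n t\<bar> \<le> \<bar>G (Suc n) s - G (Suc n) t\<bar> + \<bar>G n s - G n t\<bar>"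
        unfolding H_def by linarith
      also have "\<dots> \<le> vertex_slope_bound (c (Suc n)) * \<bar>s - t\<bar> + vertex_slope_bound (c n) * \<bar>s - t\<bar>"
        unfolding G_def by (intro add_mono piecewise_linear_code_lipschitz vl)
      finally show ?thesis by (simp add: L_eq distrib_right)
    qed
    show "H n t = 0" if "real (E n) \<le> \<bar>t\<bar>" for t
    proof -
      have "real (c n) < \<bar>t\<bar>" "real (c (Suc n)) < \<bar>t\<bar>"
        using that by (auto simp: E_def)
      then show ?thesis
        by (simp add: H_def G_def piecewise_linear_code_support)
    qed
  qed simp
  have G_cont: "continuous_on UNIV (G n)" for n
  proof -
    have "(vertex_slope_bound (c n))-lipschitz_on UNIV (G n)"
      unfolding G_def using piecewise_linear_code_lipschitz[OF vl] vertex_slope_bound_nonneg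
      by (intro lipschitz_onI) (auto simp: dist_real_def)
    then show ?thesis by (rule lipschitz_on_continuous_on)
  qed
  have G_support: "G n t = 0" if "real (c n) < \<bar>t\<bar>" for n t
    using that by (simp add: G_def piecewise_linear_code_support)
  have G_int: "integrable lebesgue (G n)" for n
  proof -
    have "integrable lborel (\<lambda>t. indicator {- real (c n)..real (c n)} t *\<^sub>R G n t)"
      by (intro borel_integrable_compact continuous_on_subset[OF G_cont]) auto
    moreover have "indicator {- real (c n)..real (c n)} t *\<^sub>R G n t = G n t" for t
      using G_support[of n t] by (cases "real (c n) < \<bar>t\<bar>") (auto simp: indicator_def not_less abs_le_iff)
    ultimately have "integrable lborel (G n)" by (simp only:)
    then show ?thesis by (simp add: integrable_completion borel_measurable_integrable)
  qed
  have H_integral: "(LINT t|lborel. H n t) \<le> 2 / 4 ^ n" for n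
  proof -
    have "(LINT t|lborel. H n t) = (LINT t|lebesgue. H n t)"
      using sampled_function.borel[OF sampled] by (intro integral_completion[symmetric]) simp
    also have "\<dots> \<le> (LINT t|lebesgue. \<bar>G (Suc n) t - f t\<bar> + \<bar>G n t - f t\<bar>)"
    proof (rule integral_mono)
      show "integrable lebesgue (H n)"
        unfolding H_def by (intro integrable_abs Bochner_Integration.integrable_diff G_int)
      show "integrable lebesgue (\<lambda>t. \<bar>G (Suc n) t - f t\<bar> + \<bar>G n t - f t\<bar>)"
        by (intro Bochner_Integration.integrable_add integrable_abs Bochner_Integration.integrable_diff G_int f)
    qed (simp add: H_def)
    also have "\<dots> = (LINT t|lebesgue. \<bar>G (Suc n) t - f t\<bar>) + (LINT t|lebesgue. \<bar>G n t - f t\<bar>)"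
      by (intro Bochner_Integration.integral_add integrable_abs Bochner_Integration.integrable_diff G_int f)
    also have "\<dots> \<le> 1 / 4 ^ Suc n + 1 / 4 ^ n"
      by (intro add_mono L1)
    also have "\<dots> \<le> 2 / 4 ^ n" by (simp add: field_simps)
    finally show ?thesis .
  qed

  define D where "D n j = dense_cell (H n) (E n) (P n) (e n) j" for n j
  define a where "a n j = (if D n j then grid_point (E n) (P n) j - 1 / 2 ^ P n else 0)" for n j
  define b where "b n j = (if D n j then grid_point (E n) (P n) (Suc j) else 0)" for n j
  have point: "computable i \<Longrightarrow> computable j \<Longrightarrow> computable_rat (\<lambda>n. grid_point (E (i n)) (P (i n)) (j n))" for i j
    unfolding grid_point_def by (intro computable_rat_intros computable_intros E P)
  have sum: "computable_rat (\<lambda>n. grid_sum (H (i n)) (E (i n)) (P (i n)) (k n))"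
    if "computable i" "computable k" for i k
    unfolding grid_sum_def H_def G_def
    by (intro computable_rat_sum computable_rat_intros computable_rat_piecewise_linear vl c' point
        computable.comp[OF that(1)] that computable_intros)
  have D: "decidable (\<lambda>n. D (i n) (j n))" if "computable i" "computable j" for i j
    unfolding D_def dense_cell_def e_def
    by (intro decidable_disj decidable_bex decidable_conj decidable_rat_less computable_rat_intros sum
        computable.comp[OF that(1)] computable.comp[OF that(2)] that computable_intros E P)

  have "\<exists>N. \<forall>n\<ge>N. \<forall>i<2 * E n * 2 ^ P n. x \<notin> {a n i<..<b n i}"
  proof (rule schnorr_borel_cantelli[OF x])
    show "computable_rat (\<lambda>m. a (fst (prod_decode m)) (snd (prod_decode m)))"
      unfolding a_def by (intro computable_rat_intros D point computable_intros P)
    show "computable_rat (\<lambda>m. b (fst (prod_decode m)) (snd (prod_decode m)))"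
      unfolding b_def by (intro computable_rat_intros D point computable_intros P)
    show "computable (\<lambda>n. 2 * E n * 2 ^ P n)"
      by (intro computable_intros E P)
    \<comment> \<open>One number has to bound the endpoints and be the exponent of a grid: the
      leftmost endpoint is at least \<open>- E n - 1\<close>, and \<open>1 / 2 ^ P n\<close> is a
      multiple of \<open>1 / 2 ^ (E n + P n + 1)\<close>.\<close>
    show "computable (\<lambda>n. E n + P n + 1)"
      by (intro computable_intros E P)
    fix n i :: nat
    have int: "z * 2 ^ (E n + P n + 1) \<in> \<int>" if "z * 2 ^ P n \<in> \<int>" for z :: real
    proof -
      have "z * 2 ^ (E n + P n + 1) = z * 2 ^ P n * 2 ^ (E n + 1)"
        by (simp add: power_add)
      then show ?thesis using that by (metis Ints_mult Ints_numeral Ints_power)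
    qed
    have point_int: "grid_point (E n) (P n) j * 2 ^ P n \<in> \<int>" for j
      by (simp add: grid_point_def left_diff_distrib)
    show "a n i * 2 ^ (E n + P n + 1) \<in> \<int>"
      using point_int[of i] by (intro int) (simp add: a_def left_diff_distrib)
    show "b n i * 2 ^ (E n + P n + 1) \<in> \<int>"
      using point_int[of "Suc i"] by (intro int) (simp add: b_def)
    have "1 / 2 ^ P n \<le> (1 :: real)" by simp
    moreover have "0 \<le> real i / 2 ^ P n" by simp
    ultimately have "- real (E n + P n + 1) \<le> grid_point (E n) (P n) i - 1 / 2 ^ P n"
      unfolding grid_point_def by linarith
    then show "- real (E n + P n + 1) \<le> a n i"
      by (simp add: a_def)
    assume "i < 2 * E n * 2 ^ P n"
    then have "real (Suc i) \<le> real (2 * E n * 2 ^ P n)"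
      by (simp only: of_nat_le_iff Suc_le_eq)
    then have "real (Suc i) / 2 ^ P n \<le> 2 * real (E n)"
      by (simp add: pos_divide_le_eq)
    then have "grid_point (E n) (P n) (Suc i) \<le> real (E n + P n + 1)"
      unfolding grid_point_def by linarith
    then show "b n i \<le> real (E n + P n + 1)"
      by (simp add: b_def)
  next
    fix n
    have "e n * measure lborel (\<Union>j<2 * E n * 2 ^ P n. {a n j<..<b n j}) \<le>
        4 * ((LINT t|lborel. H n t) + real (L n) / 2 ^ P n * (2 * real (E n)))"
      by (intro sampled_function.measure_dense_cells[OF sampled]) (simp_all add: e_def a_def b_def D_def)
    also have "\<dots> \<le> 4 * (2 / 4 ^ n + 1 / 4 ^ n)"
      by (intro mult_left_mono add_mono H_integral mesh) simp
    \<comment> \<open>The numerator 12 is rounded up to a power of two; division by the threshold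
      then gives \<open>2 ^ s / 2 ^ n\<close> with \<open>s = 4\<close>.\<close>
    also have "\<dots> \<le> 16 / 4 ^ n" by (simp add: field_simps)
    also have "(4::real) ^ n = 2 ^ n * 2 ^ n" by (simp flip: power_mult_distrib)
    finally show "measure lborel (\<Union>j<2 * E n * 2 ^ P n. {a n j<..<b n j}) \<le> 2 ^ 4 / 2 ^ n"
      by (simp add: e_def field_simps)
  qed
  then obtain N where N: "\<And>n i. N \<le> n \<Longrightarrow> i < 2 * E n * 2 ^ P n \<Longrightarrow> x \<notin> {a n i<..<b n i}"
    by blast
  obtain M :: nat where M: "\<bar>x\<bar> < real M" using reals_Archimedean2 by blast
  have sparse: "\<bar>x\<bar> < real (E n) \<and> \<not> D n (nat \<lfloor>(x + real (E n)) * 2 ^ P n\<rfloor>)" if "max N M \<le> n" for n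
  proof -
    define j where "j = nat \<lfloor>(x + real (E n)) * 2 ^ P n\<rfloor>"
    have xE: "\<bar>x\<bar> < real (E n)" using M that by (simp add: E_def)
    then have j: "j < 2 * E n * 2 ^ P n"
      unfolding j_def by (intro sampled_function.index_less_ncells[OF sampled]) auto
    have "x \<in> {grid_point (E n) (P n) j..<grid_point (E n) (P n) (Suc j)}"
      using xE unfolding sampled_function.in_cell_iff[OF sampled] j_def by auto
    moreover have "0 < 1 / (2 :: real) ^ P n" by simp
    \<comment> \<open>The extension to the left turns membership in a half-open cell into membership
      in an open interval.\<close>
    ultimately have "x \<in> {grid_point (E n) (P n) j - 1 / 2 ^ P n<..<grid_point (E n) (P n) (Suc j)}"
      unfolding atLeastLessThan_iff greaterThanLessThan_iff by linarith
    then have "D n j \<Longrightarrow> x \<in> {a n j<..<b n j}"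
      by (simp add: a_def b_def)
    then show ?thesis
      using N[OF _ j] that xE j_def by auto
  qed
  have "(\<lambda>n. (1 / 4 :: real) ^ n) \<longlonglongrightarrow> 0"
    by (rule LIMSEQ_power_zero) simp
  then have lim: "(\<lambda>n. LINT t|lebesgue. \<bar>G n t - f t\<bar>) \<longlonglongrightarrow> 0"
    by (rule Lim_null_comparison[rotated]) (use L1 in \<open>auto simp: power_one_over\<close>)
  show ?thesis
  proof (rule poisson_integral_tendsto_of_maximal_bounds[where A = 10 and N = "max N M",
        OF f G_cont G_support lim])
    fix n assume n: "max N M \<le> n"
    note bounds = sampled_function.bounds_at_sparse_cell[OF sampled e_le
        conjunct1[OF sparse[OF n]] conjunct2[OF sparse[OF n], unfolded D_def]]
    show "\<bar>G (Suc n) x - G n x\<bar> \<le> 10 / 2 ^ n"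
      using bounds(1) by (simp add: H_def e_def)
    show "(LINT t|lborel. indicator {x - r..x + r} t * \<bar>G (Suc n) t - G n t\<bar>) \<le> 10 / 2 ^ n * r" if "0 < r" for r
      using bounds(2)[OF that] by (simp add: H_def e_def)
  qed
qed

theorem theorem4p1:
  fixes x :: real and f :: "real \<Rightarrow> real"
  assumes "schnorr_random x"
    and "L1_computable f"
  shows "\<exists>v. L1_value f x v \<and> ((\<lambda>y. poisson_integral f x y) \<longlongrightarrow> v) (at_right 0)"
proof -
  have f: "integrable lebesgue f"
    using assms(2) by (simp add: L1_computable_def)
  \<comment> \<open>Indices \<open>2 * n + s\<close> turn the rate \<open>1 / 2 ^ n\<close> along
    the modulus into \<open>1 / 4 ^ n\<close>; the two parities \<open>s = 0\<close> and
    \<open>s = 1\<close> together recover the full sequence.\<close>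
  have subseq: "\<exists>v. (\<lambda>n. F (m (2 * n + s)) x) \<longlonglongrightarrow> v \<and>
      ((\<lambda>y. poisson_integral f x y) \<longlongrightarrow> v) (at_right 0)"
    if approx: "L1_approximation F m f" for F m s
  proof -
    obtain c where c: "computable c" "\<And>n. vertex_list (vertices_of_code (c n))"
      "\<And>n. F n = piecewise_linear (vertices_of_code (c n))"
      using approx unfolding L1_approximation_def computable_pl_sequence_def by blast
    have m: "computable m" "\<And>n k. m n \<le> k \<Longrightarrow> (LINT t|lebesgue. \<bar>F k t - f t\<bar>) \<le> 1 / 2 ^ n"
      using approx unfolding L1_approximation_def by blast+
    have "\<exists>v. (\<lambda>n. piecewise_linear (vertices_of_code (c (m (2 * n + s)))) x) \<longlonglongrightarrow> v \<and>
      ((\<lambda>y. poisson_integral f x y) \<longlongrightarrow> v) (at_right 0)"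
    proof (rule schnorr_random_poisson_limit[OF assms(1) f])
      show "computable (\<lambda>n. c (m (2 * n + s)))"
        by (intro computable.comp[OF c(1)] computable.comp[OF m(1)] computable_intros)
      show "(LINT t|lebesgue. \<bar>piecewise_linear (vertices_of_code (c (m (2 * n + s)))) t - f t\<bar>) \<le> 1 / 4 ^ n" for n
      proof -
        have "(LINT t|lebesgue. \<bar>F (m (2 * n + s)) t - f t\<bar>) \<le> 1 / 2 ^ (2 * n + s)"
          by (rule m(2)) simp
        also have "\<dots> \<le> 1 / 2 ^ (2 * n)"
          by (intro divide_left_mono power_increasing) auto
        finally show ?thesis by (simp add: c(3) power_mult)
      qed
    qed (rule c(2))
    then show ?thesis by (simp add: c(3))
  qed
  obtain F m where "L1_approximation F m f"
    using assms(2) by (auto simp: L1_computable_def)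
  \<comment> \<open>The Poisson limit does not involve the approximation, so this \<open>v\<close>
    serves for all of them.\<close>
  from subseq[OF this, of 0] obtain v where v: "((\<lambda>y. poisson_integral f x y) \<longlongrightarrow> v) (at_right 0)"
    by blast
  have "(\<lambda>n. F (m n) x) \<longlonglongrightarrow> v" if approx: "L1_approximation F m f" for F m
  proof (rule limseq_even_odd)
    have "(\<lambda>n. F (m (2 * n + s)) x) \<longlonglongrightarrow> v" for s
      \<comment> \<open>The limit of the values comes paired with an equal Poisson limit, and the
        latter is unique.\<close>
      using subseq[OF approx, of s] v tendsto_unique[OF trivial_limit_at_right_real] by metis
    from this[of 0] this[of 1]
    show "(\<lambda>n. F (m (2 * n)) x) \<longlonglongrightarrow> v" "(\<lambda>n. F (m (2 * n + 1)) x) \<longlonglongrightarrow> v"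
      by simp_all
  qed
  then have "L1_value f x v"
    using assms(2) by (simp add: L1_value_def)
  then show ?thesis using v by blast
qed

end
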